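(* Let $k$ be a field and $G$ a finite group. Let $X$ be a set of representatives of the conjugacy classes of $G$ and $C_G(x)$ the centralizer of $x\in X$. The additive decomposition $\mathrm{HH}^*(kG,kG)\simeq\bigoplus_{x\in X}\mathrm H^*(C_G(x),k)$ lifts to a homotopy deformation retract of complexes given by $$\iota^*=\sum_{x\in X}\iota^x:C^*(kG,kG)\to\bigoplus_{x\in X}C^*(C_G(x),k),\qquad\rho^*=\sum_{x\in X}\rho^x:\bigoplus_{x\in X}C^*(C_G(x),k)\to C^*(kG,kG),$$ and $s^*=\sum_{x\in X}s^x$ on $C^*(kG,kG)$; that is, $\iota^*$ and $\rho^*$ are morphisms of complexes (inducing the additive decomposition on cohomology), $\iota^*\circ\rho^*=\mathrm{id}$, and $\mathrm{id}-\rho^*\circ\iota^*=\delta^*\circ s^*+s^*\circ\delta^*$.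
   Context: Notation. $\overline G=G\setminus\{1\}$; $g_{i,j}$ denotes $g_i,\dots,g_j$ (empty if $j<i$). $C^n(kG,kG)=\mathrm{Map}(\overline G^{\times n},kG)$ (normalized Hochschild cochains, computing $\mathrm{HH}^*(kG,kG)$) with $\delta(\varphi)(g_{1,n+1})=g_1\varphi(g_{2,n+1})+\sum_{i=1}^n(-1)^i\varphi(g_{1,i-1},g_ig_{i+1},g_{i+2,n+1})+(-1)^{n+1}\varphi(g_{1,n})g_{n+1}$. For a group $H$, $C^n(H,k)=\mathrm{Map}(\overline H^{\times n},k)$ is the normalized group cochain complex with trivial coefficients, $\delta(\psi)(h_{1,n+1})=\psi(h_{2,n+1})+\sum_{i=1}^n(-1)^i\psi(h_{1,i-1},h_ih_{i+1},h_{i+2,n+1})+(-1)^{n+1}\psi(h_{1,n})$. All cochains are extended by $0$ to tuples with an entry equal to $1$. For $x\in X$ let $C_x$ be the conjugacy class of $x$ and $\mathcal H_x^n=\{\varphi\in C^n(kG,kG):\varphi(g_{1,n})\in k[g_1\cdots g_nC_x]\ \forall g_i\}$; then $C^*(kG,kG)=\bigoplus_{x\in X}\mathcal H_x^*$ as complexes. Fix a right coset decomposition $G=C_G(x)\gamma_{1,x}\cup\dots\cup C_G(x)\gamma_{n_x,x}$ with $\gamma_{1,x}=1$, and put $x_i=\gamma_{i,x}^{-1}x\gamma_{i,x}$, so $x_1=x$ and $C_x=\{x_1,\dots,x_{n_x}\}$. Given $g_1,\dots,g_n\in G$ and $i$, the elements $h_{i_1},\dots,h_{i_n}\in C_G(x)$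 and indices $s_i^1,\dots,s_i^n$ are determined by $\gamma_{i,x}g_1=h_{i_1}\gamma_{s_i^1,x},\ \gamma_{s_i^1,x}g_2=h_{i_2}\gamma_{s_i^2,x},\dots,\gamma_{s_i^{n-1},x}g_n=h_{i_n}\gamma_{s_i^n,x}$; set $s_i^0=i$. The maps (each extended by $0$ on the other summands) are: - $\iota^x:\mathcal H_x^n\to C^n(C_G(x),k)$: $\iota^x(\varphi)(h_{1,n})$ is the coefficient of $x$ in $\varphi(h_{1,n})h_n^{-1}\cdots h_1^{-1}\in kC_x$. - $\rho^x:C^n(C_G(x),k)\to\mathcal H_x^n$: $\rho^x(\psi)(g_{1,n})=\sum_{i=1}^{n_x}\psi(h_{i_1},\dots,h_{i_n})\,x_ig_1\cdots g_n$. - $s^x:\mathcal H_x^n\to\mathcal H_x^{n-1}$ (zero for $n=0$): $s^x(\varphi)(g_{1,n-1})=\sum_{j=0}^{n-1}\sum_{i=1}^{n_x}(-1)^ja_{i,j}\,x_ig_1\cdots g_{n-1}$, where $a_{i,j}$ is the coefficient of $x_1=x$ in $\varphi(h_{i_1},\dots,h_{i_j},\gamma_{s_i^j,x},g_{j+1},\dots,g_{n-1})\,g_{n-1}^{-1}\cdots g_1^{-1}\gamma_{i,x}^{-1}\in kC_x$. *)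

theory Defs
  imports
    Complex_Main
    "HOL-Algebra.Coset"
    "HOL-Library.FuncSet"
    "HOL-Library.Function_Algebras"
    "HOL-Library.Set_Algebras"
begin

text \<open>
  Complexes are graded by the natural numbers.  The degree-\<open>n\<close> part is a subspace
  \<open>cochains C n\<close> of an ambient vector space with scalar multiplication \<open>scalar C\<close>, and
  \<open>differential C n\<close> is the differential from degree \<open>n\<close> to degree \<open>n + 1\<close>.  Maps are only
  constrained on these subspaces.
\<close>

record ('k, 'a) cochain_cpx =
  cochains :: "nat \<Rightarrow> 'a set"
  scalar :: "'k \<Rightarrow> 'a \<Rightarrow> 'a"
  differential :: "nat \<Rightarrow> 'a \<Rightarrow> 'a"

definition linear_from_to ::
    "('k \<Rightarrow> 'a \<Rightarrow> 'a) \<Rightarrow> 'a set \<Rightarrow> ('k \<Rightarrow> 'b \<Rightarrow> 'b) \<Rightarrow> 'b set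
      \<Rightarrow> ('a::ab_group_add \<Rightarrow> 'b::ab_group_add) \<Rightarrow> bool" where
  "linear_from_to scA A scB B f \<longleftrightarrow>
     f \<in> A \<rightarrow> B \<and>
     (\<forall>a\<in>A. \<forall>b\<in>A. f (a + b) = f a + f b) \<and>
     (\<forall>c. \<forall>a\<in>A. f (scA c a) = scB c (f a))"

definition cochain_complex :: "('k::field, 'a::ab_group_add) cochain_cpx \<Rightarrow> bool" where
  "cochain_complex C \<longleftrightarrow>
     vector_space (scalar C) \<and>
     (\<forall>n. module.subspace (scalar C) (cochains C n)) \<and>
     (\<forall>n. linear_from_to (scalar C) (cochains C n) (scalar C) (cochains C (n + 1)) (differential C n)) \<and>
     (\<forall>n. \<forall>a\<in>cochains C n. differential C (n + 1) (differential C n a) = 0)"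

definition cochain_map ::
    "('k::field, 'a::ab_group_add) cochain_cpx \<Rightarrow> ('k, 'b::ab_group_add) cochain_cpx
      \<Rightarrow> (nat \<Rightarrow> 'a \<Rightarrow> 'b) \<Rightarrow> bool" where
  "cochain_map C D f \<longleftrightarrow>
     (\<forall>n. linear_from_to (scalar C) (cochains C n) (scalar D) (cochains D n) (f n)) \<and>
     (\<forall>n. \<forall>a\<in>cochains C n. f (n + 1) (differential C n a) = differential D n (f n a))"

text \<open>
  The homotopy \<open>s\<close> has degree \<open>-1\<close>: \<open>s n\<close> goes from degree \<open>n\<close> to degree \<open>n - 1\<close>, with the
  convention that the degree \<open>-1\<close> part of \<open>C\<close> is zero.
\<close>

definition homotopy_deformation_retract ::
    "('k::field, 'a::ab_group_add) cochain_cpx \<Rightarrow> ('k, 'b::ab_group_add) cochain_cpx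
      \<Rightarrow> (nat \<Rightarrow> 'a \<Rightarrow> 'b) \<Rightarrow> (nat \<Rightarrow> 'b \<Rightarrow> 'a) \<Rightarrow> (nat \<Rightarrow> 'a \<Rightarrow> 'a) \<Rightarrow> bool" where
  "homotopy_deformation_retract C D \<iota> \<rho> s \<longleftrightarrow>
     cochain_complex C \<and> cochain_complex D \<and>
     cochain_map C D \<iota> \<and> cochain_map D C \<rho> \<and>
     (\<forall>n. linear_from_to (scalar C) (cochains C (n + 1)) (scalar C) (cochains C n) (s (n + 1))) \<and>
     (\<forall>a\<in>cochains C 0. s 0 a = 0) \<and>
     (\<forall>n. \<forall>b\<in>cochains D n. \<iota> n (\<rho> n b) = b) \<and>
     (\<forall>n. \<forall>a\<in>cochains C n.
        a - \<rho> n (\<iota> n a) =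
          (if n = 0 then 0 else differential C (n - 1) (s n a)) + s (n + 1) (differential C n a))"

definition direct_sum_complex ::
    "'i set \<Rightarrow> ('i \<Rightarrow> ('k, 'a::ab_group_add) cochain_cpx) \<Rightarrow> ('k, 'i \<Rightarrow> 'a) cochain_cpx" where
  "direct_sum_complex I C =
     \<lparr> cochains = (\<lambda>n. {a. (\<forall>i\<in>I. a i \<in> cochains (C i) n) \<and> (\<forall>i. i \<notin> I \<longrightarrow> a i = 0) \<and>
                          finite {i. a i \<noteq> 0}}),
       scalar = (\<lambda>c a i. scalar (C i) c (a i)),
       differential = (\<lambda>n a i. if i \<in> I then differential (C i) n (a i) else 0) \<rparr>"

definition cocycles :: "('k, 'a::ab_group_add) cochain_cpx \<Rightarrow> nat \<Rightarrow> 'a set" where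
  "cocycles C n = {z \<in> cochains C n. differential C n z = 0}"

definition coboundaries :: "('k, 'a::ab_group_add) cochain_cpx \<Rightarrow> nat \<Rightarrow> 'a set" where
  "coboundaries C n = (if n = 0 then {0} else differential C (n - 1) ` cochains C (n - 1))"

text \<open>
  Cohomology classes are the cosets of the coboundaries in the cocycles.  Addition of classes
  is the elementwise sum of sets; adding the coboundaries in \<open>class_scale\<close> only matters for
  the scalar zero.
\<close>

definition cohomology :: "('k, 'a::ab_group_add) cochain_cpx \<Rightarrow> nat \<Rightarrow> 'a set set" where
  "cohomology C n = (\<lambda>z. {z} + coboundaries C n) ` cocycles C n"

definition class_scale ::
    "('k, 'a::ab_group_add) cochain_cpx \<Rightarrow> nat \<Rightarrow> 'k \<Rightarrow> 'a set \<Rightarrow> 'a set" where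
  "class_scale C n c K = scalar C c ` K + coboundaries C n"

text \<open>For a cochain map \<open>f\<close> into \<open>D\<close>, this sends the class of \<open>z\<close> to the class of \<open>f z\<close>.\<close>

definition induced_map ::
    "('k, 'b::ab_group_add) cochain_cpx \<Rightarrow> nat \<Rightarrow> ('a \<Rightarrow> 'b) \<Rightarrow> 'a set \<Rightarrow> 'b set" where
  "induced_map D n f K = f ` K + coboundaries D n"

text \<open>
  Families \<open>f\<close> from \<open>C\<close> to \<open>D i\<close> and \<open>r\<close> from \<open>D i\<close> to \<open>C\<close>, for \<open>i\<close> in the finite set \<open>I\<close>,
  induce mutually inverse linear isomorphisms between the cohomology of \<open>C\<close> in degree \<open>n\<close> and
  the direct sum over \<open>I\<close> of the cohomologies of the \<open>D i\<close> in degree \<open>n\<close>.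
\<close>

definition induce_inverse_cohomology_isos ::
    "('k::field, 'a::ab_group_add) cochain_cpx \<Rightarrow> 'i set \<Rightarrow> ('i \<Rightarrow> ('k, 'b::ab_group_add) cochain_cpx)
      \<Rightarrow> nat \<Rightarrow> ('i \<Rightarrow> 'a \<Rightarrow> 'b) \<Rightarrow> ('i \<Rightarrow> 'b \<Rightarrow> 'a) \<Rightarrow> bool" where
  "induce_inverse_cohomology_isos C I D n f r \<longleftrightarrow>
     (let F = (\<lambda>K. \<lambda>i\<in>I. induced_map (D i) n (f i) K);
          R = (\<lambda>L. \<Sum>i\<in>I. induced_map C n (r i) (L i));
          S = (\<Pi>\<^sub>E i\<in>I. cohomology (D i) n)
      in bij_betw F (cohomology C n) S \<and>
         (\<forall>K\<in>cohomology C n. \<forall>L\<in>cohomology C n. F (K + L) = (\<lambda>i\<in>I. F K i + F L i)) \<and>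
         (\<forall>c. \<forall>K\<in>cohomology C n.
            F (class_scale C n c K) = (\<lambda>i\<in>I. class_scale (D i) n c (F K i))) \<and>
         (\<forall>K\<in>cohomology C n. R (F K) = K) \<and>
         (\<forall>L\<in>S. F (R L) = L))"

definition conj_class :: "('g, 'm) monoid_scheme \<Rightarrow> 'g \<Rightarrow> 'g set" where
  "conj_class G x = {inv\<^bsub>G\<^esub> g \<otimes>\<^bsub>G\<^esub> x \<otimes>\<^bsub>G\<^esub> g | g. g \<in> carrier G}"

definition centralizer :: "('g, 'm) monoid_scheme \<Rightarrow> 'g \<Rightarrow> 'g set" where
  "centralizer G x = {h \<in> carrier G. h \<otimes>\<^bsub>G\<^esub> x = x \<otimes>\<^bsub>G\<^esub> h}"

abbreviation centralizer_group :: "('g, 'm) monoid_scheme \<Rightarrow> 'g \<Rightarrow> ('g, 'm) monoid_scheme" where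
  "centralizer_group G x \<equiv> G\<lparr>carrier := centralizer G x\<rparr>"

definition conj_class_representatives :: "('g, 'm) monoid_scheme \<Rightarrow> 'g set \<Rightarrow> bool" where
  "conj_class_representatives G X \<longleftrightarrow>
     X \<subseteq> carrier G \<and> (\<forall>g\<in>carrier G. \<exists>!x. x \<in> X \<and> g \<in> conj_class G x)"

definition right_coset_decomposition ::
    "('g, 'm) monoid_scheme \<Rightarrow> 'g set \<Rightarrow> nat \<Rightarrow> (nat \<Rightarrow> 'g) \<Rightarrow> bool" where
  "right_coset_decomposition G H N \<gamma> \<longleftrightarrow>
     (\<forall>i\<in>{1..N}. \<gamma> i \<in> carrier G) \<and> \<gamma> 1 = \<one>\<^bsub>G\<^esub> \<and>
     bij_betw (\<lambda>i. H #>\<^bsub>G\<^esub> \<gamma> i) {1..N} (rcosets\<^bsub>G\<^esub> H)"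

text \<open>
  The pair \<open>(h, s)\<close> determined by \<open>\<gamma> i g = h \<gamma> s\<close>, and its iteration along a list: for
  \<open>gs = [g\<^sub>1, \<dots>, g\<^sub>n]\<close>, \<open>coset_elements\<close> is \<open>[h\<^sub>i\<^sub>1, \<dots>, h\<^sub>i\<^sub>n]\<close> and \<open>coset_index\<close> is the last
  index \<open>s\<^sub>i\<^sup>n\<close>.
\<close>

definition coset_step ::
    "('g, 'm) monoid_scheme \<Rightarrow> 'g set \<Rightarrow> nat \<Rightarrow> (nat \<Rightarrow> 'g) \<Rightarrow> nat \<Rightarrow> 'g \<Rightarrow> 'g \<times> nat" where
  "coset_step G H N \<gamma> i g =
     (THE p. fst p \<in> H \<and> snd p \<in> {1..N} \<and> \<gamma> i \<otimes>\<^bsub>G\<^esub> g = fst p \<otimes>\<^bsub>G\<^esub> \<gamma> (snd p))"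

fun coset_elements ::
    "('g, 'm) monoid_scheme \<Rightarrow> 'g set \<Rightarrow> nat \<Rightarrow> (nat \<Rightarrow> 'g) \<Rightarrow> nat \<Rightarrow> 'g list \<Rightarrow> 'g list" where
  "coset_elements G H N \<gamma> i [] = []"
| "coset_elements G H N \<gamma> i (g # gs) =
     fst (coset_step G H N \<gamma> i g) # coset_elements G H N \<gamma> (snd (coset_step G H N \<gamma> i g)) gs"

fun coset_index ::
    "('g, 'm) monoid_scheme \<Rightarrow> 'g set \<Rightarrow> nat \<Rightarrow> (nat \<Rightarrow> 'g) \<Rightarrow> nat \<Rightarrow> 'g list \<Rightarrow> nat" where
  "coset_index G H N \<gamma> i [] = i"
| "coset_index G H N \<gamma> i (g # gs) = coset_index G H N \<gamma> (snd (coset_step G H N \<gamma> i g)) gs"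

text \<open>
  Elements of \<open>kG\<close> are coefficient functions \<open>'g \<Rightarrow> 'k\<close> vanishing outside the carrier (all
  groups here are finite); \<open>free_span S\<close> is the \<open>k\<close>-linear span \<open>k[S]\<close> of a set of group
  elements.
\<close>

definition free_span :: "'g set \<Rightarrow> ('g \<Rightarrow> 'k::field) set" where
  "free_span S = {a. \<forall>u. u \<notin> S \<longrightarrow> a u = 0}"

definition ga_basis :: "'g \<Rightarrow> 'g \<Rightarrow> 'k::field" where
  "ga_basis g = (\<lambda>u. if u = g then 1 else 0)"

definition ga_mult :: "('g, 'm) monoid_scheme \<Rightarrow> ('g \<Rightarrow> 'k::field) \<Rightarrow> ('g \<Rightarrow> 'k) \<Rightarrow> 'g \<Rightarrow> 'k" where
  "ga_mult G a b =
     (\<lambda>u. \<Sum>(v, w)\<in>{(v, w). v \<in> carrier G \<and> w \<in> carrier G \<and> v \<otimes>\<^bsub>G\<^esub> w = u}. a v * b w)"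

definition list_mult :: "('g, 'm) monoid_scheme \<Rightarrow> 'g list \<Rightarrow> 'g" where
  "list_mult G gs = foldr (\<otimes>\<^bsub>G\<^esub>) gs \<one>\<^bsub>G\<^esub>"

text \<open>
  A tuple \<open>g\<^sub>1, \<dots>, g\<^sub>n\<close> of non-identity elements is a list of length \<open>n\<close>.  Cochains are extended
  by zero to all other lists, in particular to those with an entry equal to the identity.
  Lists are indexed from \<open>0\<close>, so \<open>g\<^sub>i\<close> is \<open>gs ! (i - 1)\<close>.
\<close>

definition tuples :: "('g, 'm) monoid_scheme \<Rightarrow> nat \<Rightarrow> 'g list set" where
  "tuples G n = {gs. length gs = n \<and> set gs \<subseteq> carrier G - {\<one>\<^bsub>G\<^esub>}}"

definition merge_at :: "('g, 'm) monoid_scheme \<Rightarrow> nat \<Rightarrow> 'g list \<Rightarrow> 'g list" where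
  "merge_at G i gs = take (i - 1) gs @ [gs ! (i - 1) \<otimes>\<^bsub>G\<^esub> gs ! i] @ drop (i + 1) gs"

definition hochschild_complex ::
    "('g, 'm) monoid_scheme \<Rightarrow> ('k::field, 'g list \<Rightarrow> 'g \<Rightarrow> 'k) cochain_cpx" where
  "hochschild_complex G =
     \<lparr> cochains = (\<lambda>n. {\<phi>. (\<forall>gs\<in>tuples G n. \<phi> gs \<in> free_span (carrier G)) \<and>
                          (\<forall>gs. gs \<notin> tuples G n \<longrightarrow> \<phi> gs = 0)}),
       scalar = (\<lambda>c \<phi> gs u. c * \<phi> gs u),
       differential = (\<lambda>n \<phi> gs.
         if gs \<in> tuples G (n + 1) then
           (\<lambda>u. ga_mult G (ga_basis (hd gs)) (\<phi> (tl gs)) u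
                + (\<Sum>i=1..n. (- 1) ^ i * \<phi> (merge_at G i gs) u)
                + (- 1) ^ (n + 1) * ga_mult G (\<phi> (butlast gs)) (ga_basis (last gs)) u)
         else 0) \<rparr>"

definition group_complex ::
    "('g, 'm) monoid_scheme \<Rightarrow> ('k::field, 'g list \<Rightarrow> 'k) cochain_cpx" where
  "group_complex H =
     \<lparr> cochains = (\<lambda>n. {\<psi>. \<forall>hs. hs \<notin> tuples H n \<longrightarrow> \<psi> hs = 0}),
       scalar = (\<lambda>c \<psi> hs. c * \<psi> hs),
       differential = (\<lambda>n \<psi> hs.
         if hs \<in> tuples H (n + 1) then
           \<psi> (tl hs) + (\<Sum>i=1..n. (- 1) ^ i * \<psi> (merge_at H i hs))
           + (- 1) ^ (n + 1) * \<psi> (butlast hs)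
         else 0) \<rparr>"

definition hochschild_summand ::
    "('g, 'm) monoid_scheme \<Rightarrow> 'g \<Rightarrow> nat \<Rightarrow> ('g list \<Rightarrow> 'g \<Rightarrow> 'k::field) set" where
  "hochschild_summand G x n =
     {\<phi> \<in> cochains (hochschild_complex G) n.
        \<forall>gs\<in>tuples G n. \<phi> gs \<in> free_span (list_mult G gs <#\<^bsub>G\<^esub> conj_class G x)}"

text \<open>
  The projection onto \<open>hochschild_summand G x n\<close> along the other summands; see
  \<open>hochschild_decomposition\<close> below.
\<close>

definition summand_projection ::
    "('g, 'm) monoid_scheme \<Rightarrow> 'g \<Rightarrow> ('g list \<Rightarrow> 'g \<Rightarrow> 'k::field) \<Rightarrow> 'g list \<Rightarrow> 'g \<Rightarrow> 'k" where
  "summand_projection G x \<phi> =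
     (\<lambda>gs u. if u \<in> list_mult G gs <#\<^bsub>G\<^esub> conj_class G x then \<phi> gs u else 0)"

definition iota_part ::
    "('g, 'm) monoid_scheme \<Rightarrow> 'g \<Rightarrow> nat \<Rightarrow> ('g list \<Rightarrow> 'g \<Rightarrow> 'k::field) \<Rightarrow> 'g list \<Rightarrow> 'k" where
  "iota_part G x n \<phi> = (\<lambda>hs.
     if hs \<in> tuples (centralizer_group G x) n
     then ga_mult G (\<phi> hs) (ga_basis (list_mult G (rev (map (m_inv G) hs)))) x
     else 0)"

definition rho_part ::
    "('g, 'm) monoid_scheme \<Rightarrow> 'g \<Rightarrow> nat \<Rightarrow> (nat \<Rightarrow> 'g) \<Rightarrow> nat
      \<Rightarrow> ('g list \<Rightarrow> 'k::field) \<Rightarrow> 'g list \<Rightarrow> 'g \<Rightarrow> 'k" where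
  "rho_part G x N \<gamma> n \<psi> = (\<lambda>gs.
     if gs \<in> tuples G n then
       (\<lambda>u. \<Sum>i=1..N. \<psi> (coset_elements G (centralizer G x) N \<gamma> i gs) *
              ga_basis ((inv\<^bsub>G\<^esub> \<gamma> i \<otimes>\<^bsub>G\<^esub> x \<otimes>\<^bsub>G\<^esub> \<gamma> i) \<otimes>\<^bsub>G\<^esub> list_mult G gs) u)
     else 0)"

definition homotopy_coeff ::
    "('g, 'm) monoid_scheme \<Rightarrow> 'g \<Rightarrow> nat \<Rightarrow> (nat \<Rightarrow> 'g)
      \<Rightarrow> ('g list \<Rightarrow> 'g \<Rightarrow> 'k::field) \<Rightarrow> 'g list \<Rightarrow> nat \<Rightarrow> nat \<Rightarrow> 'k" where
  "homotopy_coeff G x N \<gamma> \<phi> gs i j =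
     ga_mult G
       (\<phi> (coset_elements G (centralizer G x) N \<gamma> i (take j gs)
            @ [\<gamma> (coset_index G (centralizer G x) N \<gamma> i (take j gs))]
            @ drop j gs))
       (ga_basis (list_mult G (rev (map (m_inv G) gs)) \<otimes>\<^bsub>G\<^esub> inv\<^bsub>G\<^esub> \<gamma> i)) x"

definition homotopy_part ::
    "('g, 'm) monoid_scheme \<Rightarrow> 'g \<Rightarrow> nat \<Rightarrow> (nat \<Rightarrow> 'g) \<Rightarrow> nat
      \<Rightarrow> ('g list \<Rightarrow> 'g \<Rightarrow> 'k::field) \<Rightarrow> 'g list \<Rightarrow> 'g \<Rightarrow> 'k" where
  "homotopy_part G x N \<gamma> n \<phi> = (\<lambda>gs.
     if n \<noteq> 0 \<and> gs \<in> tuples G (n - 1) then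
       (\<lambda>u. \<Sum>j=0..n - 1. \<Sum>i=1..N. (- 1) ^ j * homotopy_coeff G x N \<gamma> \<phi> gs i j *
              ga_basis ((inv\<^bsub>G\<^esub> \<gamma> i \<otimes>\<^bsub>G\<^esub> x \<otimes>\<^bsub>G\<^esub> \<gamma> i) \<otimes>\<^bsub>G\<^esub> list_mult G gs) u)
     else 0)"

text \<open>
  The total maps.  The composition with \<open>summand_projection\<close> is the extension by zero to the
  other summands.  The coset decomposition for \<open>x\<close> is given by \<open>N x\<close> and \<open>\<gamma> x\<close>.
\<close>

definition iota ::
    "('g, 'm) monoid_scheme \<Rightarrow> 'g set \<Rightarrow> nat
      \<Rightarrow> ('g list \<Rightarrow> 'g \<Rightarrow> 'k::field) \<Rightarrow> 'g \<Rightarrow> 'g list \<Rightarrow> 'k" where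
  "iota G X n \<phi> = (\<lambda>x. if x \<in> X then iota_part G x n (summand_projection G x \<phi>) else 0)"

definition rho ::
    "('g, 'm) monoid_scheme \<Rightarrow> 'g set \<Rightarrow> ('g \<Rightarrow> nat) \<Rightarrow> ('g \<Rightarrow> nat \<Rightarrow> 'g) \<Rightarrow> nat
      \<Rightarrow> ('g \<Rightarrow> 'g list \<Rightarrow> 'k::field) \<Rightarrow> 'g list \<Rightarrow> 'g \<Rightarrow> 'k" where
  "rho G X N \<gamma> n \<Psi> = (\<Sum>x\<in>X. rho_part G x (N x) (\<gamma> x) n (\<Psi> x))"

definition homotopy ::
    "('g, 'm) monoid_scheme \<Rightarrow> 'g set \<Rightarrow> ('g \<Rightarrow> nat) \<Rightarrow> ('g \<Rightarrow> nat \<Rightarrow> 'g) \<Rightarrow> nat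
      \<Rightarrow> ('g list \<Rightarrow> 'g \<Rightarrow> 'k::field) \<Rightarrow> 'g list \<Rightarrow> 'g \<Rightarrow> 'k" where
  "homotopy G X N \<gamma> n \<phi> =
     (\<Sum>x\<in>X. homotopy_part G x (N x) (\<gamma> x) n (summand_projection G x \<phi>))"

lemma sum_fun_apply: "(\<Sum>x\<in>A. f x) y = (\<Sum>x\<in>A. f x y)"
  by (induction A rule: infinite_finite_induct) auto

lemma list_mult_closed:
  fixes G (structure)
  assumes "group G" "set gs \<subseteq> carrier G"
  shows "list_mult G gs \<in> carrier G"
proof -
  interpret group G by fact
  show ?thesis using assms(2) by (induction gs) (auto simp: list_mult_def)
qed

lemma hochschild_decomposition:
  fixes G :: "('g, 'm) monoid_scheme" (structure)
    and \<phi> :: "'g list \<Rightarrow> 'g \<Rightarrow> 'k::field"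
  assumes "group G" "finite (carrier G)" "conj_class_representatives G X"
  shows "\<And>x. x \<in> X \<Longrightarrow> \<phi> \<in> cochains (hochschild_complex G) n
            \<Longrightarrow> summand_projection G x \<phi> \<in> hochschild_summand G x n"
    and "\<phi> \<in> cochains (hochschild_complex G) n
            \<Longrightarrow> (\<Sum>x\<in>X. summand_projection G x \<phi>) = \<phi>"
    and "\<And>x. \<phi> \<in> hochschild_summand G x n \<Longrightarrow> summand_projection G x \<phi> = \<phi>"
    and "\<And>x y. x \<in> X \<Longrightarrow> y \<in> X \<Longrightarrow> x \<noteq> y \<Longrightarrow> \<phi> \<in> hochschild_summand G y n
            \<Longrightarrow> summand_projection G x \<phi> = 0"
proof -
  interpret group G by fact
  have finX: "finite X"
    using assms finite_subset unfolding conj_class_representatives_def by blast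
  have conj_carrier: "conj_class G x \<subseteq> carrier G" if "x \<in> X" for x
    using that assms(3) unfolding conj_class_def conj_class_representatives_def by auto
  have mem_iff: "u \<in> p <# conj_class G x \<longleftrightarrow> u \<in> carrier G \<and> inv p \<otimes> u \<in> conj_class G x"
    if "x \<in> X" "p \<in> carrier G" for x p u
  proof
    assume "u \<in> p <# conj_class G x"
    then obtain c where c: "c \<in> conj_class G x" "u = p \<otimes> c"
      unfolding l_coset_def by auto
    moreover have "c \<in> carrier G" using c conj_carrier that by auto
    ultimately show "u \<in> carrier G \<and> inv p \<otimes> u \<in> conj_class G x"
      using that by (simp add: m_assoc[symmetric])
  next
    assume *: "u \<in> carrier G \<and> inv p \<otimes> u \<in> conj_class G x"
    then have "u = p \<otimes> (inv p \<otimes> u)" using that by (simp add: m_assoc[symmetric])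
    then show "u \<in> p <# conj_class G x" using * unfolding l_coset_def by blast
  qed
  have tup: "list_mult G gs \<in> carrier G" if "gs \<in> tuples G n" for gs
    using that list_mult_closed[OF assms(1)] unfolding tuples_def by auto
  show "summand_projection G x \<phi> \<in> hochschild_summand G x n"
    if "x \<in> X" "\<phi> \<in> cochains (hochschild_complex G) n" for x
    using that unfolding hochschild_summand_def hochschild_complex_def summand_projection_def
    by (auto simp: free_span_def fun_eq_iff)
  show "summand_projection G x \<phi> = \<phi>" if "\<phi> \<in> hochschild_summand G x n" for x
  proof (intro ext)
    fix gs u
    show "summand_projection G x \<phi> gs u = \<phi> gs u"
      using that unfolding hochschild_summand_def hochschild_complex_def summand_projection_def
      by (cases "gs \<in> tuples G n") (auto simp: free_span_def)
  qed
  have uniq: "\<exists>!x. x \<in> X \<and> u \<in> p <# conj_class G x"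
    if "u \<in> carrier G" "p \<in> carrier G" for u p
  proof -
    have "inv p \<otimes> u \<in> carrier G" using that by simp
    then have "\<exists>!x. x \<in> X \<and> inv p \<otimes> u \<in> conj_class G x"
      using assms(3) unfolding conj_class_representatives_def by blast
    moreover have "(x \<in> X \<and> u \<in> p <# conj_class G x) \<longleftrightarrow> (x \<in> X \<and> inv p \<otimes> u \<in> conj_class G x)"
      for x using mem_iff that by blast
    ultimately show ?thesis by simp
  qed
  show "summand_projection G x \<phi> = 0"
    if xy: "x \<in> X" "y \<in> X" "x \<noteq> y" and \<phi>: "\<phi> \<in> hochschild_summand G y n" for x y
  proof (intro ext)
    fix gs u
    show "summand_projection G x \<phi> gs u = 0 gs u"
    proof (cases "gs \<in> tuples G n \<and> u \<in> list_mult G gs <# conj_class G x")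
      case True
      then have "u \<in> carrier G" using mem_iff xy tup by blast
      then have "u \<notin> list_mult G gs <# conj_class G y"
        using uniq[of u "list_mult G gs"] True xy tup by blast
      then show ?thesis
        using \<phi> True unfolding hochschild_summand_def summand_projection_def
        by (auto simp: free_span_def)
    next
      case False
      then show ?thesis
        using \<phi> unfolding hochschild_summand_def hochschild_complex_def summand_projection_def
        by auto
    qed
  qed
  show "(\<Sum>x\<in>X. summand_projection G x \<phi>) = \<phi>"
    if \<phi>: "\<phi> \<in> cochains (hochschild_complex G) n"
  proof (intro ext)
    fix gs u
    show "(\<Sum>x\<in>X. summand_projection G x \<phi>) gs u = \<phi> gs u"
    proof (cases "gs \<in> tuples G n \<and> u \<in> carrier G")
      case True
      then have "\<exists>!x. x \<in> X \<and> u \<in> list_mult G gs <# conj_class G x"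
        using uniq tup by simp
      then obtain x where x: "x \<in> X" "u \<in> list_mult G gs <# conj_class G x"
        and un: "\<And>y. y \<in> X \<Longrightarrow> u \<in> list_mult G gs <# conj_class G y \<Longrightarrow> y = x"
        by (elim ex1E) auto
      have *: "summand_projection G y \<phi> gs u = (if y = x then \<phi> gs u else 0)" if "y \<in> X" for y
      proof (cases "y = x")
        case True
        then show ?thesis using x by (simp add: summand_projection_def)
      next
        case False
        then have "u \<notin> list_mult G gs <# conj_class G y" using un that by blast
        then show ?thesis using False by (simp add: summand_projection_def)
      qed
      have "(\<Sum>y\<in>X. summand_projection G y \<phi>) gs u = (\<Sum>y\<in>X. summand_projection G y \<phi> gs u)"
        by (simp only: sum_fun_apply)
      also have "\<dots> = (\<Sum>y\<in>X. if y = x then \<phi> gs u else 0)"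
        by (rule sum.cong[OF refl *])
      finally show ?thesis using finX x by simp
    next
      case False
      then have "\<phi> gs u = 0" using \<phi> unfolding hochschild_complex_def
        by (auto simp: free_span_def)
      then show ?thesis by (simp add: sum_fun_apply summand_projection_def cong: if_cong)
    qed
  qed
qed

end

theory Submission
  imports Defs
begin

text \<open>
  A Hochschild cochain becomes transparent after a shift of coordinates: let \<open>\<Phi>(y; g\<^sub>1, \<dots>, g\<^sub>n)\<close>
  be the coefficient of \<open>y g\<^sub>1 \<cdots> g\<^sub>n\<close> in \<open>\<phi>(g\<^sub>1, \<dots>, g\<^sub>n)\<close> (\<open>conj_coords\<close>).  In the Hochschild
  differential all faces except the first one then leave \<open>y\<close> alone, and the first one replaces
  \<open>y\<close> by its conjugate \<open>g\<^sub>1\<inverse> y g\<^sub>1\<close> (\<open>hochschild_differential_coords\<close>).  Hence the Hochschild complex is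
  the complex of normalized cochains on the nerve of the groupoid in which \<open>G\<close> acts on itself
  by conjugation.

  This groupoid retracts onto the disjoint union of the one-object groupoids \<open>C\<^sub>G(x)\<close>, \<open>x \<in> X\<close>.
  The points of the class of \<open>x\<close> are \<open>x\<^sub>i = \<gamma>\<^sub>i\<inverse> x \<gamma>\<^sub>i\<close>; the retraction sends each \<open>x\<^sub>i\<close> to \<open>x\<close>, and the arrow
  \<open>g\<close> from \<open>x\<^sub>i\<close> to \<open>x\<^sub>s\<close> to the element \<open>h\<close> of the centralizer with \<open>\<gamma>\<^sub>i g = h \<gamma>\<^sub>s\<close>.  The same equation
  says that the arrows \<open>\<gamma>\<^sub>i\<close> from \<open>x\<close> to \<open>x\<^sub>i\<close> form a natural transformation from the retraction to
  the identity.  In these coordinates \<open>\<iota>\<close> is the restriction of cochains to the objects \<open>x \<in> X\<close>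
  (\<open>iota_apply\<close>), \<open>\<rho>\<close> is the pullback along the retraction (\<open>rho_coords\<close>), and \<open>s\<close> is the prism operator
  of the natural transformation (\<open>homotopy_coords\<close>).  So \<open>\<iota>\<close> and \<open>\<rho>\<close> are cochain maps,
  \<open>\<iota> \<circ> \<rho> = id\<close> because \<open>\<gamma>\<^sub>1 = 1\<close>, and the homotopy identity is the usual one for prisms.

  The combinatorial core is \<open>prism_upper_faces\<close>: for the alternating sum of all faces but the first one,
  prisms and faces anticommute up to the term given by the retraction.  Alternating sums and prisms are
  defined by recursion on lists, with the cochain as a varying argument; each identity between
  faces then becomes a short induction that uses only a single relation between neighbouring entries.

  The statement on cohomology is formal: a deformation retract onto a finite direct sum induces
  inverse isomorphisms with the direct sum of the cohomologies (\<open>retract_onto_direct_sum_cohomology\<close>).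
\<close>

section \<open>Face operators on lists\<close>

text \<open>
  For \<open>g\<^sub>1, \<dots>, g\<^sub>n\<close> this is \<open>\<Sum>\<^sub>i (-1)\<^sup>i f(d\<^sub>i(g\<^sub>1, \<dots>, g\<^sub>n))\<close> over \<open>1 \<le> i \<le> n\<close>, where \<open>d\<^sub>i\<close> merges two neighbours
  for \<open>i < n\<close> and \<open>d\<^sub>n\<close> drops the last entry; see \<open>upper_faces_eq_sum\<close>.  Separating these faces from \<open>d\<^sub>0\<close>
  isolates the only face that can move the base point of a simplex.
\<close>
fun upper_faces ::
    "('g, 'm) monoid_scheme \<Rightarrow> ('g list \<Rightarrow> 'a::ab_group_add) \<Rightarrow> 'g list \<Rightarrow> 'a" where
  "upper_faces G f [] = 0"
| "upper_faces G f [g] = - f []"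
| "upper_faces G f (g # h # gs) =
     - f (g \<otimes>\<^bsub>G\<^esub> h # gs) - upper_faces G (\<lambda>t. f (g # t)) (h # gs)"

text \<open>
  The differential of cochains on the nerve of an action groupoid.  A simplex is a starting point
  \<open>y\<close> with a list of group elements that act one after the other.
\<close>
fun nerve_differential ::
    "('g, 'm) monoid_scheme \<Rightarrow> ('e \<Rightarrow> 'g \<Rightarrow> 'e) \<Rightarrow> ('e \<Rightarrow> 'g list \<Rightarrow> 'a::ab_group_add)
      \<Rightarrow> 'e \<Rightarrow> 'g list \<Rightarrow> 'a" where
  "nerve_differential G act \<Phi> y [] = 0"
| "nerve_differential G act \<Phi> y (g # gs) = \<Phi> (act y g) gs + upper_faces G (\<Phi> y) (g # gs)"

lemma upper_faces_eq_sum: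
  fixes f :: "'g list \<Rightarrow> 'k::comm_ring_1"
  assumes "length gs = Suc n"
  shows "upper_faces G f gs =
    (\<Sum>i=1..n. (- 1) ^ i * f (merge_at G i gs)) + (- 1) ^ (n + 1) * f (butlast gs)"
  using assms
proof (induction G f gs arbitrary: n rule: upper_faces.induct)
  case (3 G f g h gs)
  then obtain m where m: "n = Suc m" "length (h # gs) = Suc m" by auto
  have "(\<Sum>i=1..n. (- 1) ^ i * f (merge_at G i (g # h # gs))) =
      - f (g \<otimes>\<^bsub>G\<^esub> h # gs) + (\<Sum>i=1..m. (- 1) ^ Suc i * f (merge_at G (Suc i) (g # h # gs)))"
    unfolding m(1) by (simp add: sum.atLeast_Suc_atMost merge_at_def
        sum.shift_bounds_cl_Suc_ivl del: sum.cl_ivl_Suc)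
  also have "(\<Sum>i=1..m. (- 1) ^ Suc i * f (merge_at G (Suc i) (g # h # gs))) =
      (\<Sum>i=1..m. - ((- 1) ^ i * f (g # merge_at G i (h # gs))))"
  proof (rule sum.cong[OF refl])
    fix i assume "i \<in> {1..m}"
    then obtain j where "i = Suc j" by (cases i) auto
    then show "(- 1) ^ Suc i * f (merge_at G (Suc i) (g # h # gs)) =
        - ((- 1) ^ i * f (g # merge_at G i (h # gs)))"
      by (simp add: merge_at_def)
  qed
  finally show ?case
    using "3.IH"[OF m(2)] m by (simp add: sum_negf)
qed auto

lemma upper_faces_carrier_update [simp]: "upper_faces (G\<lparr>carrier := H\<rparr>) f gs = upper_faces G f gs"
  by (induction gs arbitrary: f rule: induct_list012) auto

lemma upper_faces_zero [simp]: "upper_faces G (\<lambda>t. 0) gs = 0"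
  by (induction gs rule: induct_list012) auto

lemma upper_faces_add:
  "upper_faces G (\<lambda>t. f t + f' t) gs = upper_faces G f gs + upper_faces G f' gs"
  by (induction gs arbitrary: f f' rule: induct_list012) auto

lemma upper_faces_minus: "upper_faces G (\<lambda>t. - f t) gs = - upper_faces G f gs"
  by (induction gs arbitrary: f rule: induct_list012) auto

lemma upper_faces_diff:
  "upper_faces G (\<lambda>t. f t - f' t) gs = upper_faces G f gs - upper_faces G f' gs"
  using upper_faces_add[of G f "\<lambda>t. - f' t" gs] by (simp add: upper_faces_minus)

lemma upper_faces_cmult:
  fixes f :: "'g list \<Rightarrow> 'k::comm_ring_1"
  shows "upper_faces G (\<lambda>t. c * f t) gs = c * upper_faces G f gs"
  by (induction gs arbitrary: f rule: induct_list012) (auto simp: right_diff_distrib)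

lemma nerve_differential_carrier_update [simp]:
  "nerve_differential (G\<lparr>carrier := H\<rparr>) act \<Phi> y gs = nerve_differential G act \<Phi> y gs"
  by (cases gs) auto

text \<open>
  Group cochains with trivial coefficients are the constant families, for any action.
\<close>
lemma nerve_differential_const:
  "nerve_differential G act (\<lambda>_. f) y gs = nerve_differential G act' (\<lambda>_. f) y' gs"
  by (cases gs) auto

definition normalized :: "('g, 'm) monoid_scheme \<Rightarrow> ('g list \<Rightarrow> 'a::zero) \<Rightarrow> bool" where
  "normalized G f \<longleftrightarrow> (\<forall>gs. \<one>\<^bsub>G\<^esub> \<in> set gs \<longrightarrow> f gs = 0)"

lemma normalized_Cons: "normalized G f \<Longrightarrow> normalized G (\<lambda>t. f (g # t))"
  by (auto simp: normalized_def)

context group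
begin

lemma upper_faces_cong:
  assumes "set gs \<subseteq> carrier G"
    and "\<And>t. set t \<subseteq> carrier G \<Longrightarrow> Suc (length t) = length gs \<Longrightarrow> f t = f' t"
  shows "upper_faces G f gs = upper_faces G f' gs"
  using assms
proof (induction gs arbitrary: f f' rule: induct_list012)
  case (3 g h gs)
  have "upper_faces G (\<lambda>t. f (g # t)) (h # gs) = upper_faces G (\<lambda>t. f' (g # t)) (h # gs)"
    by (rule "3.IH"(2)) (use "3.prems" in auto)
  then show ?case using "3.prems" by simp
qed auto

text \<open>
  The simplicial identities among \<open>d\<^sub>1, \<dots>, d\<^sub>n\<close> do not involve \<open>d\<^sub>0\<close>, so these faces alone already form
  a differential.
\<close>
lemma upper_faces_upper_faces:
  assumes "set gs \<subseteq> carrier G"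
  shows "upper_faces G (upper_faces G f) gs = 0"
  using assms
proof (induction gs arbitrary: f rule: induct_list012)
  case (3 g h gs)
  \<comment> \<open>The face that merges \<open>g\<close> into the head of its argument.\<close>
  define F where "F = (\<lambda>t. case t of [] \<Rightarrow> f [] | t1 # t' \<Rightarrow> f (g \<otimes> t1 # t'))"
  have step: "upper_faces G f (g # t) = - F t - upper_faces G (\<lambda>u. f (g # u)) t" for t
    by (cases t) (auto simp: F_def)
  have F: "upper_faces G F (h # gs) = upper_faces G f (g \<otimes> h # gs)"
    using "3.prems" by (cases gs) (auto simp: F_def m_assoc)
  have "upper_faces G (\<lambda>t. upper_faces G f (g # t)) (h # gs) = - upper_faces G F (h # gs)"
    unfolding step using "3.IH"(2)[of "\<lambda>u. f (g # u)"] "3.prems"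
    by (simp add: upper_faces_diff upper_faces_minus)
  then show ?case by (simp add: F)
qed auto

lemma upper_faces_one_Cons:
  assumes "normalized G f" "set gs \<subseteq> carrier G"
  shows "upper_faces G f (\<one> # gs) = - f gs"
proof (cases gs)
  case (Cons h t)
  have "(\<lambda>t. f (\<one> # t)) = (\<lambda>t. 0)" using assms(1) by (auto simp: normalized_def)
  then show ?thesis using Cons assms by simp
qed simp

text \<open>
  An identity at a position after the first one is absorbed by the two merges adjacent to it
  (or by one merge and the final face), and these two terms have opposite signs; all other faces still contain
  the identity.
\<close>
lemma upper_faces_degenerate:
  assumes "normalized G f" "set (g # gs) \<subseteq> carrier G" "\<one> \<in> set gs"
  shows "upper_faces G f (g # gs) = 0"
  using assms
proof (induction gs arbitrary: f g)
  case (Cons h gs)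
  note norm = normalized_Cons[OF Cons.prems(1), of g]
  show ?case
  proof (cases "\<one> \<in> set gs")
    case True
    then have "f (g \<otimes> h # gs) = 0" using Cons.prems(1) by (simp add: normalized_def)
    then show ?thesis using Cons.IH[OF norm, of h] Cons.prems True by simp
  next
    case False
    then have "h = \<one>" using Cons.prems(3) by simp
    then show ?thesis using upper_faces_one_Cons[OF norm] Cons.prems by simp
  qed
qed simp

end

locale right_action = group G for G :: "('g, 'm) monoid_scheme" (structure) +
  fixes E :: "'e set" and act :: "'e \<Rightarrow> 'g \<Rightarrow> 'e"
  assumes act_closed [simp]: "y \<in> E \<Longrightarrow> g \<in> carrier G \<Longrightarrow> act y g \<in> E"
    and act_one [simp]: "y \<in> E \<Longrightarrow> act y \<one> = y"
    and act_mult: "y \<in> E \<Longrightarrow> g \<in> carrier G \<Longrightarrow> h \<in> carrier G \<Longrightarrow> act y (g \<otimes> h) = act (act y g) h"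
begin

lemma nerve_differential_cong:
  assumes "y \<in> E" "set gs \<subseteq> carrier G"
    and "\<And>z t. z \<in> E \<Longrightarrow> set t \<subseteq> carrier G \<Longrightarrow> Suc (length t) = length gs \<Longrightarrow> \<Phi> z t = \<Psi> z t"
  shows "nerve_differential G act \<Phi> y gs = nerve_differential G act \<Psi> y gs"
  using assms upper_faces_cong[of gs "\<Phi> y" "\<Psi> y"] by (cases gs) auto

lemma nerve_differential_squared:
  assumes "y \<in> E" "set gs \<subseteq> carrier G"
  shows "nerve_differential G act (nerve_differential G act \<Phi>) y gs = 0"
proof (cases gs)
  case (Cons g gs')
  show ?thesis
  proof (cases gs')
    case (Cons h r)
    have "upper_faces G (upper_faces G (\<Phi> y)) (g # h # r) = 0"
      using upper_faces_upper_faces assms \<open>gs = g # gs'\<close> Cons by blast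
    then show ?thesis
      using \<open>gs = g # gs'\<close> Cons assms by (simp add: upper_faces_add act_mult)
  qed (use \<open>gs = g # gs'\<close> in simp)
qed simp

text \<open>
  Consequently the differential formula remains correct on degenerate tuples, where the normalized
  complexes put the value zero.  This matters because the elements \<open>h\<close> attached to a tuple without
  identities may well be identities.
\<close>
lemma nerve_differential_degenerate:
  assumes "y \<in> E" "set gs \<subseteq> carrier G" "\<one> \<in> set gs" "\<And>z. z \<in> E \<Longrightarrow> normalized G (\<Phi> z)"
  shows "nerve_differential G act \<Phi> y gs = 0"
proof (cases gs)
  case (Cons g r)
  have norm: "normalized G (\<Phi> y)" and norm': "normalized G (\<Phi> (act y g))"
    using assms Cons by auto
  show ?thesis
  proof (cases "g = \<one>")
    case True
    then show ?thesis using upper_faces_one_Cons[OF norm, of r] assms Cons by simp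
  next
    case False
    then have "\<one> \<in> set r" using assms Cons by simp
    then show ?thesis
      using upper_faces_degenerate[OF norm, of g r] norm' assms Cons by (simp add: normalized_def)
  qed
qed simp

end

section \<open>Transversals\<close>

text \<open>
  Coset representatives \<open>\<gamma>\<^sub>1, \<dots>, \<gamma>\<^sub>N\<close> of a subgroup turn right multiplication by \<open>g\<close> into a step
  \<open>\<gamma>\<^sub>i g = h \<gamma>\<^sub>s\<close>.
\<close>
locale right_transversal = group G for G :: "('g, 'm) monoid_scheme" (structure) +
  fixes H :: "'g set" and N :: nat and \<gamma> :: "nat \<Rightarrow> 'g"
  assumes subgroup_H: "subgroup H G"
    and decomposition: "right_coset_decomposition G H N \<gamma>"
begin

lemma H_carrier [simp]: "h \<in> H \<Longrightarrow> h \<in> carrier G"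
  using subgroup.subset[OF subgroup_H] by auto

lemma gamma_closed [simp]: "i \<in> {1..N} \<Longrightarrow> \<gamma> i \<in> carrier G"
  using decomposition by (auto simp: right_coset_decomposition_def)

lemma gamma_one: "\<gamma> (Suc 0) = \<one>"
  using decomposition by (auto simp: right_coset_decomposition_def)

lemma coset_representation_unique:
  assumes "h \<in> H" "h' \<in> H" "s \<in> {1..N}" "s' \<in> {1..N}" "h \<otimes> \<gamma> s = h' \<otimes> \<gamma> s'"
  shows "h = h' \<and> s = s'"
proof -
  have "H #> \<gamma> t = H #> (k \<otimes> \<gamma> t)" if "k \<in> H" "t \<in> {1..N}" for k t
  proof -
    have "H #> (k \<otimes> \<gamma> t) = (H #> k) #> \<gamma> t"
      using that subgroup.subset[OF subgroup_H] by (simp add: coset_mult_assoc)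
    then show ?thesis using coset_join2[OF H_carrier[OF that(1)] subgroup_H that(1)] by simp
  qed
  from this[OF assms(1,3)] this[OF assms(2,4)] have "H #> \<gamma> s = H #> \<gamma> s'"
    using assms(5) by simp
  moreover have "inj_on (\<lambda>i. H #> \<gamma> i) {1..N}"
    using decomposition by (simp add: right_coset_decomposition_def bij_betw_def)
  ultimately have "s = s'" using assms(3,4) by (simp only: inj_onD)
  moreover have "h = h'"
    using assms(5) right_cancel[of "\<gamma> s" h h'] H_carrier[OF assms(1)] H_carrier[OF assms(2)]
      gamma_closed[OF assms(3)] unfolding \<open>s = s'\<close> by blast
  ultimately show ?thesis by simp
qed

lemma coset_representation_exists:
  assumes "g \<in> carrier G"
  obtains h s where "h \<in> H" "s \<in> {1..N}" "g = h \<otimes> \<gamma> s"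
proof -
  have "H #> g \<in> rcosets H" using assms subgroup.subset[OF subgroup_H] by (auto simp: RCOSETS_def)
  then have "H #> g \<in> (\<lambda>i. H #> \<gamma> i) ` {1..N}"
    using decomposition by (simp add: right_coset_decomposition_def bij_betw_def)
  then obtain s where s: "s \<in> {1..N}" "H #> g = H #> \<gamma> s" by blast
  have "g \<in> H #> \<gamma> s" using s(2) rcos_self[OF assms subgroup_H] by simp
  then show ?thesis using that s(1) by (auto simp: r_coset_def)
qed

lemma one_index: "Suc 0 \<in> {1..N}"
  by (rule coset_representation_exists[OF one_closed]) auto

abbreviation step_elem where "step_elem i g \<equiv> fst (coset_step G H N \<gamma> i g)"
abbreviation step_index where "step_index i g \<equiv> snd (coset_step G H N \<gamma> i g)"
abbreviation elements where "elements \<equiv> coset_elements G H N \<gamma>"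
abbreviation index where "index \<equiv> coset_index G H N \<gamma>"

lemma coset_step_eqI:
  assumes "h \<in> H" "s \<in> {1..N}" "\<gamma> i \<otimes> g = h \<otimes> \<gamma> s"
  shows "coset_step G H N \<gamma> i g = (h, s)"
  unfolding coset_step_def
proof (rule the_equality)
  fix p assume "fst p \<in> H \<and> snd p \<in> {1..N} \<and> \<gamma> i \<otimes> g = fst p \<otimes> \<gamma> (snd p)"
  then have "fst p = h \<and> snd p = s"
    using assms by (intro coset_representation_unique) auto
  then show "p = (h, s)" by (simp add: prod_eq_iff)
qed (use assms in simp)

lemma coset_step:
  assumes "i \<in> {1..N}" "g \<in> carrier G"
  shows "step_elem i g \<in> H" "step_index i g \<in> {1..N}"
    and "\<gamma> i \<otimes> g = step_elem i g \<otimes> \<gamma> (step_index i g)"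
proof -
  obtain h s where hs: "h \<in> H" "s \<in> {1..N}" "\<gamma> i \<otimes> g = h \<otimes> \<gamma> s"
    using coset_representation_exists[OF m_closed[OF gamma_closed[OF assms(1)] assms(2)]] .
  have eq: "step_elem i g = h" "step_index i g = s" by (simp_all only: coset_step_eqI[OF hs] fst_conv snd_conv)
  show "step_elem i g \<in> H" "step_index i g \<in> {1..N}"
    and "\<gamma> i \<otimes> g = step_elem i g \<otimes> \<gamma> (step_index i g)"
    unfolding eq by (fact hs)+
qed

text \<open>
  The steps are functorial: \<open>\<gamma>\<^sub>i g g' = h \<gamma>\<^sub>s g' = h h' \<gamma>\<^sub>t\<close>.
\<close>
lemma coset_step_mult:
  assumes "i \<in> {1..N}" "g \<in> carrier G" "h \<in> carrier G"
  shows "coset_step G H N \<gamma> i (g \<otimes> h) =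
    (step_elem i g \<otimes> step_elem (step_index i g) h, step_index (step_index i g) h)"
proof -
  define a s where "a = step_elem i g" and "s = step_index i g"
  define b t where "b = step_elem s h" and "t = step_index s h"
  have 1: "a \<in> H" "s \<in> {1..N}" "\<gamma> i \<otimes> g = a \<otimes> \<gamma> s"
    unfolding a_def s_def by (fact coset_step[OF assms(1,2)])+
  have 2: "b \<in> H" "t \<in> {1..N}" "\<gamma> s \<otimes> h = b \<otimes> \<gamma> t"
    unfolding b_def t_def by (fact coset_step[OF 1(2) assms(3)])+
  note cl = H_carrier[OF 1(1)] H_carrier[OF 2(1)] gamma_closed[OF assms(1)]
    gamma_closed[OF 1(2)] gamma_closed[OF 2(2)]
  have "\<gamma> i \<otimes> (g \<otimes> h) = (\<gamma> i \<otimes> g) \<otimes> h" using cl assms by (simp add: m_assoc)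
  also have "\<dots> = a \<otimes> (\<gamma> s \<otimes> h)" unfolding 1(3) using cl assms by (simp add: m_assoc)
  also have "\<dots> = a \<otimes> b \<otimes> \<gamma> t" unfolding 2(3) using cl by (simp add: m_assoc)
  finally have "coset_step G H N \<gamma> i (g \<otimes> h) = (a \<otimes> b, t)"
    by (rule coset_step_eqI[OF subgroup.m_closed[OF subgroup_H 1(1) 2(1)] 2(2)])
  then show ?thesis by (simp only: a_def s_def b_def t_def)
qed

lemma coset_step_one: "i \<in> {1..N} \<Longrightarrow> coset_step G H N \<gamma> i \<one> = (\<one>, i)"
  by (rule coset_step_eqI) (simp_all add: subgroup.one_closed[OF subgroup_H])

lemma coset_step_subgroup: "h \<in> H \<Longrightarrow> coset_step G H N \<gamma> (Suc 0) h = (h, Suc 0)"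
  by (rule coset_step_eqI) (use one_index in \<open>simp_all add: gamma_one\<close>)

lemma length_elements [simp]: "length (elements i gs) = length gs"
  by (induction gs arbitrary: i) auto

lemma elements_in_H:
  assumes "i \<in> {1..N}" "set gs \<subseteq> carrier G"
  shows "set (elements i gs) \<subseteq> H"
  using assms
proof (induction gs arbitrary: i)
  case (Cons g gs)
  have "step_elem i g \<in> H" "step_index i g \<in> {1..N}" using coset_step[of i g] Cons.prems by auto
  then show ?case using Cons by auto
qed simp

lemma index_closed:
  assumes "i \<in> {1..N}" "set gs \<subseteq> carrier G"
  shows "index i gs \<in> {1..N}"
  using assms
proof (induction gs arbitrary: i)
  case (Cons g gs)
  have "step_index i g \<in> {1..N}" using coset_step[of i g] Cons.prems by auto
  then show ?case using Cons by auto
qed simp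

lemma elements_subgroup: "set hs \<subseteq> H \<Longrightarrow> elements (Suc 0) hs = hs"
  by (induction hs) (auto simp: coset_step_subgroup)

lemma one_in_elements:
  assumes "i \<in> {1..N}" "set gs \<subseteq> carrier G" "\<one> \<in> set gs"
  shows "\<one> \<in> set (elements i gs)"
  using assms
proof (induction gs arbitrary: i)
  case (Cons g gs)
  have "step_index i g \<in> {1..N}" using coset_step[of i g] Cons.prems by auto
  then show ?case using Cons by (auto simp: coset_step_one)
qed simp

text \<open>
  By telescoping of the steps \<open>\<gamma>\<^sub>i g = h \<gamma>\<^sub>s\<close>.
\<close>
lemma list_mult_elements:
  assumes "i \<in> {1..N}" "set gs \<subseteq> carrier G"
  shows "list_mult G (elements i gs) \<otimes> \<gamma> (index i gs) = \<gamma> i \<otimes> list_mult G gs"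
  using assms
proof (induction gs arbitrary: i)
  case Nil
  then show ?case by (simp add: list_mult_def)
next
  case (Cons g gs)
  note s = coset_step[of i g]
  have i': "step_index i g \<in> {1..N}" and gs: "set gs \<subseteq> carrier G" and "g \<in> carrier G"
    using s Cons.prems by auto
  have cl: "list_mult G gs \<in> carrier G"
    "list_mult G (elements (step_index i g) gs) \<in> carrier G"
    "\<gamma> (index (step_index i g) gs) \<in> carrier G"
    using list_mult_closed[OF is_group] gs elements_in_H[OF i' gs] H_carrier index_closed[OF i' gs]
    by (blast intro: gamma_closed H_carrier)+
  have "list_mult G (elements i (g # gs)) \<otimes> \<gamma> (index i (g # gs)) =
      step_elem i g \<otimes> (list_mult G (elements (step_index i g) gs) \<otimes> \<gamma> (index (step_index i g) gs))"
    using s Cons.prems cl by (simp add: list_mult_def m_assoc)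
  also have "\<dots> = step_elem i g \<otimes> (\<gamma> (step_index i g) \<otimes> list_mult G gs)"
    by (simp add: Cons.IH[OF i' gs])
  also have "\<dots> = \<gamma> i \<otimes> g \<otimes> list_mult G gs"
    using s Cons.prems cl by (simp add: m_assoc)
  also have "\<dots> = \<gamma> i \<otimes> list_mult G (g # gs)"
    using Cons.prems cl by (simp add: list_mult_def m_assoc)
  finally show ?case .
qed

text \<open>
  By functoriality of the steps, passing to the subgroup commutes with merging neighbours.
\<close>
lemma upper_faces_elements:
  assumes "i \<in> {1..N}" "set gs \<subseteq> carrier G"
  shows "upper_faces G (\<lambda>t. f (elements i t)) gs = upper_faces G f (elements i gs)"
  using assms
proof (induction gs arbitrary: i f rule: induct_list012)
  case (3 g h gs)
  have "step_index i g \<in> {1..N}" using coset_step[of i g] "3.prems" by auto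
  then show ?case
    using "3.IH"(2)[of "step_index i g" "\<lambda>t. f (step_elem i g # t)"] "3.prems"
    by (simp add: coset_step_mult)
qed auto

text \<open>
  The prism operator of the natural transformation with components \<open>\<gamma>\<^sub>i\<close>: the alternating sum over all
  ways to walk the first \<open>j\<close> steps inside the subgroup, then cross over along \<open>\<gamma>\<close>, and walk the
  remaining steps in the group; see \<open>prism_eq_sum\<close>.
\<close>
fun prism :: "('g list \<Rightarrow> 'a::ab_group_add) \<Rightarrow> nat \<Rightarrow> 'g list \<Rightarrow> 'a" where
  "prism f i [] = f [\<gamma> i]"
| "prism f i (g # gs) =
     f (\<gamma> i # g # gs) - prism (\<lambda>t. f (step_elem i g # t)) (step_index i g) gs"

lemma prism_eq_sum:
  fixes f :: "'g list \<Rightarrow> 'k::comm_ring_1"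
  shows "prism f i gs = (\<Sum>j=0..length gs.
    (- 1) ^ j * f (elements i (take j gs) @ [\<gamma> (index i (take j gs))] @ drop j gs))"
proof (induction gs arbitrary: f i)
  case (Cons g gs)
  show ?case
    unfolding prism.simps Cons.IH
    by (simp add: sum.atLeast_Suc_atMost sum.shift_bounds_cl_Suc_ivl sum_negf del: sum.cl_ivl_Suc)
qed simp

lemma prism_zero [simp]: "prism (\<lambda>t. 0) i gs = 0"
  by (induction gs arbitrary: i) auto

lemma prism_add: "prism (\<lambda>t. f t + f' t) i gs = prism f i gs + prism f' i gs"
  by (induction gs arbitrary: f f' i) auto

lemma prism_minus: "prism (\<lambda>t. - f t) i gs = - prism f i gs"
  by (induction gs arbitrary: f i) auto

lemma prism_diff: "prism (\<lambda>t. f t - f' t) i gs = prism f i gs - prism f' i gs"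
  using prism_add[of f "\<lambda>t. - f' t" i gs] by (simp add: prism_minus)

lemma prism_cmult:
  fixes f :: "'g list \<Rightarrow> 'k::comm_ring_1"
  shows "prism (\<lambda>t. c * f t) i gs = c * prism f i gs"
  by (induction gs arbitrary: f i) (auto simp: right_diff_distrib)

lemma prism_cong:
  assumes "i \<in> {1..N}" "set gs \<subseteq> carrier G"
    and "\<And>t. set t \<subseteq> carrier G \<Longrightarrow> length t = Suc (length gs) \<Longrightarrow> f t = f' t"
  shows "prism f i gs = prism f' i gs"
  using assms
proof (induction gs arbitrary: i f f')
  case Nil
  then show ?case by simp
next
  case (Cons g gs)
  note s = coset_step[of i g]
  have "prism (\<lambda>t. f (step_elem i g # t)) (step_index i g) gs =
      prism (\<lambda>t. f' (step_elem i g # t)) (step_index i g) gs"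
    by (rule Cons.IH) (use s Cons.prems in auto)
  then show ?case using Cons.prems by simp
qed

lemma prism_degenerate:
  assumes "normalized G f" "i \<in> {1..N}" "set gs \<subseteq> carrier G" "\<one> \<in> set gs"
  shows "prism f i gs = 0"
  using assms
proof (induction gs arbitrary: f i)
  case (Cons g gs)
  note s = coset_step[of i g]
  have "f (\<gamma> i # g # gs) = 0" using Cons.prems by (auto simp: normalized_def)
  moreover have "prism (\<lambda>t. f (step_elem i g # t)) (step_index i g) gs = 0"
  proof (cases "g = \<one>")
    case True
    have "(\<lambda>t. f (\<one> # t)) = (\<lambda>t. 0)" using Cons.prems(1) by (auto simp: normalized_def)
    then show ?thesis using True Cons.prems by (simp add: coset_step_one)
  next
    case False
    then show ?thesis using Cons.IH[OF normalized_Cons] Cons.prems s by auto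
  qed
  ultimately show ?case by simp
qed simp

text \<open>
  Induction on the list.  Expanding both sides at the head, the terms in which the crossing arrow is
  merged with a neighbour meet in pairs, and the pairs agree because \<open>\<gamma>\<^sub>i g = h \<gamma>\<^sub>s\<close>.  What survives is
  the last face of the last prism, in which the whole list has been moved to the subgroup and the
  crossing arrow is dropped.
\<close>
lemma prism_upper_faces:
  assumes "i \<in> {1..N}" "set gs \<subseteq> carrier G"
  shows "upper_faces G (prism f i) gs + prism (upper_faces G f) i gs = - f (elements i gs)"
  using assms
proof (induction gs arbitrary: i f)
  case (Cons g r)
  define h s where "h = step_elem i g" and "s = step_index i g"
  have hs: "h \<in> H" "s \<in> {1..N}" "\<gamma> i \<otimes> g = h \<otimes> \<gamma> s"
    using coset_step[of i g] Cons.prems by (auto simp: h_def s_def)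
  have r: "set r \<subseteq> carrier G" "g \<in> carrier G" using Cons.prems by auto
  have cl: "h \<in> carrier G" "\<gamma> i \<in> carrier G" "\<gamma> s \<in> carrier G"
    using hs Cons.prems by auto
  define f' where "f' = (\<lambda>t. f (h # t))"
  \<comment> \<open>The face that merges \<open>h\<close> into the head of its argument.\<close>
  define F where "F = (\<lambda>t. case t of [] \<Rightarrow> f [] | t1 # t' \<Rightarrow> f (h \<otimes> t1 # t'))"
  have "upper_faces G f (h # t) = - F t - upper_faces G f' t" for t
    by (cases t) (auto simp: F_def f'_def)
  then have 1: "prism (upper_faces G f) i (g # r) =
      upper_faces G f (\<gamma> i # g # r) + prism F s r + prism (upper_faces G f') s r"
    by (simp add: h_def[symmetric] s_def[symmetric] prism_diff prism_minus)
  have IH: "prism (upper_faces G f') s r = - f' (elements s r) - upper_faces G (prism f' s) r"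
    using Cons.IH[of s f'] hs r by (simp add: eq_diff_eq add.commute)
  have el: "f' (elements s r) = f (elements i (g # r))"
    by (simp add: f'_def h_def s_def)
  show ?case
  proof (cases r)
    case Nil
    then show ?thesis
      using 1 IH el hs cl by (simp add: F_def f'_def h_def[symmetric] s_def[symmetric])
  next
    case (Cons g2 r')
    have step2: "coset_step G H N \<gamma> i (g \<otimes> g2) = (h \<otimes> step_elem s g2, step_index s g2)"
      using coset_step_mult[of i g g2] Cons Cons.prems r \<open>i \<in> _\<close> by (simp add: h_def s_def)
    have 2: "upper_faces G (\<lambda>t. prism f i (g # t)) r =
        upper_faces G (\<lambda>t. f (\<gamma> i # g # t)) r - upper_faces G (prism f' s) r"
      by (simp add: upper_faces_diff f'_def h_def s_def)
    have 3: "prism F s r = f (\<gamma> i \<otimes> g # r) -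
        prism (\<lambda>t. f (h \<otimes> step_elem s g2 # t)) (step_index s g2) r'"
      using Cons hs by (simp add: F_def)
    show ?thesis
      unfolding 1 IH el 3 using 2 Cons by (simp add: step2)
  qed
qed simp

end

text \<open>
  If \<open>H\<close> fixes \<open>x\<close>, the points \<open>x \<cdot> \<gamma>\<^sub>i\<close> depend only on cosets and an element \<open>g\<close> moves \<open>x \<cdot> \<gamma>\<^sub>i\<close> to
  \<open>x \<cdot> \<gamma>\<^sub>s\<close>.  The retraction of the orbit of \<open>x\<close> onto the one object \<open>x\<close> with arrows \<open>H\<close> is \<open>elements\<close>.
\<close>
locale based_transversal = right_transversal G H N \<gamma> + right_action G E act
  for G :: "('g, 'm) monoid_scheme" (structure) and H N \<gamma> and E :: "'e set" and act +
  fixes x :: 'e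
  assumes base: "x \<in> E" and base_fixed: "h \<in> H \<Longrightarrow> act x h = x"
begin

lemma act_base_gamma:
  assumes "i \<in> {1..N}" "g \<in> carrier G"
  shows "act (act x (\<gamma> i)) g = act x (\<gamma> (step_index i g))"
proof -
  note s = coset_step[OF assms]
  have "act (act x (\<gamma> i)) g = act x (\<gamma> i \<otimes> g)"
    using assms base by (simp add: act_mult)
  also have "\<dots> = act (act x (step_elem i g)) (\<gamma> (step_index i g))"
    using s base by (simp add: act_mult)
  finally show ?thesis using s by (simp add: base_fixed)
qed

text \<open>
  Pullback along the retraction is a cochain map.
\<close>
lemma nerve_differential_pullback:
  assumes i: "i \<in> {1..N}" and gs: "set gs \<subseteq> carrier G"
    and pull: "\<And>s t. s \<in> {1..N} \<Longrightarrow> set t \<subseteq> carrier G \<Longrightarrow> Suc (length t) = length gs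
       \<Longrightarrow> \<Phi> (act x (\<gamma> s)) t = f (elements s t)"
  shows "nerve_differential G act \<Phi> (act x (\<gamma> i)) gs =
    nerve_differential G act (\<lambda>_. f) x (elements i gs)"
proof (cases gs)
  case (Cons g r)
  have "upper_faces G (\<Phi> (act x (\<gamma> i))) gs = upper_faces G (\<lambda>t. f (elements i t)) gs"
    by (rule upper_faces_cong[OF gs]) (use i pull in auto)
  then have "upper_faces G (\<Phi> (act x (\<gamma> i))) gs = upper_faces G f (elements i gs)"
    using upper_faces_elements[OF i gs] by simp
  moreover have "\<Phi> (act (act x (\<gamma> i)) g) r = f (elements (step_index i g) r)"
    using act_base_gamma[OF i, of g] pull coset_step[OF i, of g] gs Cons by simp
  ultimately show ?thesis using Cons by simp
qed simp

text \<open>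
  The upper faces are settled by \<open>prism_upper_faces\<close>.  For the zeroth face, the
  prism crossing at position \<open>0\<close> yields \<open>\<Phi>\<close> at \<open>x \<cdot> \<gamma>\<^sub>i\<close>, while for later crossings the first entry lies in
  \<open>H\<close>, which fixes \<open>x\<close>, so that they cancel against the zeroth face of \<open>\<Sigma>\<close>.  The families \<open>\<Sigma>\<close> and
  \<open>\<Delta>\<close> are constrained only on the simplices that occur, since the actual cochains vanish
  elsewhere by convention.
\<close>
lemma prism_homotopy:
  assumes i: "i \<in> {1..N}" and gs: "set gs \<subseteq> carrier G"
    and S: "\<And>s t. s \<in> {1..N} \<Longrightarrow> set t \<subseteq> carrier G \<Longrightarrow> Suc (length t) = length gs
       \<Longrightarrow> \<Sigma> (act x (\<gamma> s)) t = prism (\<Phi> x) s t"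
    and D: "\<And>t. set t \<subseteq> carrier G \<Longrightarrow> length t = Suc (length gs)
       \<Longrightarrow> \<Delta> t = nerve_differential G act \<Phi> x t"
  shows "\<Phi> (act x (\<gamma> i)) gs - \<Phi> x (elements i gs) =
    nerve_differential G act \<Sigma> (act x (\<gamma> i)) gs + prism \<Delta> i gs"
proof -
  \<comment> \<open>The zeroth face.\<close>
  define T where "T = (\<lambda>t. \<Phi> (act x (hd t)) (tl t))"
  have "prism \<Delta> i gs = prism (\<lambda>t. T t + upper_faces G (\<Phi> x) t) i gs"
  proof (rule prism_cong[OF i gs])
    fix t assume "set t \<subseteq> carrier G" "length t = Suc (length gs)"
    then show "\<Delta> t = T t + upper_faces G (\<Phi> x) t" using D by (cases t) (auto simp: T_def)
  qed
  then have 1: "prism \<Delta> i gs = prism T i gs - \<Phi> x (elements i gs) - upper_faces G (prism (\<Phi> x) i) gs"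
    using prism_upper_faces[OF i gs, of "\<Phi> x"] by (simp add: prism_add algebra_simps eq_neg_iff_add_eq_0)
  have 2: "upper_faces G (\<Sigma> (act x (\<gamma> i))) gs = upper_faces G (prism (\<Phi> x) i) gs"
    by (rule upper_faces_cong[OF gs]) (use i S in auto)
  show ?thesis
  proof (cases gs)
    case Nil
    then show ?thesis using 1 by (simp add: T_def)
  next
    case (Cons g r)
    note s = coset_step[OF i, of g]
    have "(\<lambda>t. T (step_elem i g # t)) = \<Phi> x"
      using s gs Cons by (simp add: T_def base_fixed)
    then have "prism T i gs = \<Phi> (act x (\<gamma> i)) gs - prism (\<Phi> x) (step_index i g) r"
      using Cons by (simp add: T_def)
    moreover have "\<Sigma> (act (act x (\<gamma> i)) g) r = prism (\<Phi> x) (step_index i g) r"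
      using act_base_gamma[OF i, of g] S s gs Cons by simp
    ultimately show ?thesis using 1 2 Cons by simp
  qed
qed

end

section \<open>Normalized group cochains\<close>

lemma tuplesD: "gs \<in> tuples G n \<Longrightarrow> set gs \<subseteq> carrier G" "gs \<in> tuples G n \<Longrightarrow> length gs = n"
  by (auto simp: tuples_def)

lemma group_cochains_iff:
  "\<psi> \<in> cochains (group_complex H) n \<longleftrightarrow> (\<forall>hs. hs \<notin> tuples H n \<longrightarrow> \<psi> hs = 0)"
  by (simp add: group_complex_def)

lemma group_scalar: "scalar (group_complex H) c \<psi> hs = c * \<psi> hs"
  by (simp add: group_complex_def)

lemma group_scalar_vector_space:
  "vector_space (scalar (group_complex H :: ('k::field, 'g list \<Rightarrow> 'k) cochain_cpx))"
  by (simp add: vector_space_def group_scalar fun_eq_iff algebra_simps)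

context group
begin

lemma trivial_right_action: "right_action G UNIV (\<lambda>y g. y)"
  by unfold_locales auto

lemma group_cochain_normalized: "\<psi> \<in> cochains (group_complex G) n \<Longrightarrow> normalized G \<psi>"
  by (auto simp: group_cochains_iff normalized_def tuples_def)

text \<open>
  The differential of the complex is cut off outside tuples of non-identity elements;
  normalization makes the cut-off invisible.
\<close>
lemma group_differential_eq_nerve:
  assumes \<psi>: "\<psi> \<in> cochains (group_complex G) n"
    and hs: "set hs \<subseteq> carrier G" "length hs = Suc n"
  shows "differential (group_complex G) n \<psi> hs = nerve_differential G (\<lambda>y g. y) (\<lambda>_. \<psi>) y hs"
proof (cases "\<one> \<in> set hs")
  case True
  then have "hs \<notin> tuples G (n + 1)" by (auto simp: tuples_def)
  then show ?thesis
    using right_action.nerve_differential_degenerate[OF trivial_right_action, of y hs "\<lambda>_. \<psi>"]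
      True hs group_cochain_normalized[OF \<psi>] by (simp add: group_complex_def)
next
  case False
  then have "hs \<in> tuples G (n + 1)" using hs by (auto simp: tuples_def)
  then show ?thesis
    using upper_faces_eq_sum[OF hs(2), of G \<psi>] hs
    by (cases hs) (simp_all add: group_complex_def)
qed

lemma group_complex_is_complex:
  "cochain_complex (group_complex G :: ('k::field, 'a list \<Rightarrow> 'k) cochain_cpx)"
proof -
  let ?C = "group_complex G :: ('k, 'a list \<Rightarrow> 'k) cochain_cpx"
  interpret vector_space "scalar ?C" by (rule group_scalar_vector_space)
  have sub: "subspace (cochains ?C n)" for n
    by (rule subspaceI) (simp_all add: group_cochains_iff group_scalar)
  have closed: "differential ?C n \<psi> \<in> cochains ?C (Suc n)" for n \<psi>
    by (simp add: group_complex_def)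
  have lin: "linear_from_to (scalar ?C) (cochains ?C n) (scalar ?C) (cochains ?C (n + 1)) (differential ?C n)" for n
    unfolding linear_from_to_def
  proof (intro conjI ballI allI ext)
    show "differential ?C n \<in> cochains ?C n \<rightarrow> cochains ?C (n + 1)" using closed by simp
    show "differential ?C n (a + b) hs = (differential ?C n a + differential ?C n b) hs" for a b hs
      by (simp add: group_complex_def algebra_simps sum.distrib)
    show "differential ?C n (scalar ?C c a) hs = scalar ?C c (differential ?C n a) hs" for c a hs
      by (simp add: group_complex_def algebra_simps sum_distrib_left)
  qed
  have "differential ?C (Suc n) (differential ?C n \<psi>) hs = 0"
    if \<psi>: "\<psi> \<in> cochains ?C n" for n \<psi> hs
  proof (cases "hs \<in> tuples G (Suc (Suc n))")
    case True
    then have hs: "set hs \<subseteq> carrier G" "length hs = Suc (Suc n)" by (auto simp: tuples_def)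
    interpret triv: right_action G "UNIV :: nat set" "\<lambda>y g. y" by (rule trivial_right_action)
    have "differential ?C (Suc n) (differential ?C n \<psi>) hs =
        nerve_differential G (\<lambda>y g. y) (\<lambda>_. differential ?C n \<psi>) (0 :: nat) hs"
      by (rule group_differential_eq_nerve[OF closed hs])
    also have "\<dots> = nerve_differential G (\<lambda>y g. y) (nerve_differential G (\<lambda>y g. y) (\<lambda>_. \<psi>)) (0 :: nat) hs"
      by (rule triv.nerve_differential_cong)
        (use hs in \<open>simp_all add: group_differential_eq_nerve[OF \<psi>]\<close>)
    also have "\<dots> = 0" by (rule triv.nerve_differential_squared) (use hs in auto)
    finally show ?thesis .
  next
    case False
    then show ?thesis using closed[of "Suc n"] by (simp add: group_cochains_iff)
  qed
  then show ?thesis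
    using sub lin vector_space_axioms by (simp add: cochain_complex_def fun_eq_iff)
qed

end

section \<open>Hochschild cochains in conjugation coordinates\<close>

definition conj_coords ::
    "('g, 'm) monoid_scheme \<Rightarrow> ('g list \<Rightarrow> 'g \<Rightarrow> 'k) \<Rightarrow> 'g \<Rightarrow> 'g list \<Rightarrow> 'k" where
  "conj_coords G \<phi> y gs = \<phi> gs (y \<otimes>\<^bsub>G\<^esub> list_mult G gs)"

abbreviation conj_act :: "('g, 'm) monoid_scheme \<Rightarrow> 'g \<Rightarrow> 'g \<Rightarrow> 'g" where
  "conj_act G y g \<equiv> inv\<^bsub>G\<^esub> g \<otimes>\<^bsub>G\<^esub> y \<otimes>\<^bsub>G\<^esub> g"

lemma hochschild_cochains_iff:
  "\<phi> \<in> cochains (hochschild_complex G) n \<longleftrightarrow>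
    (\<forall>gs u. gs \<notin> tuples G n \<or> u \<notin> carrier G \<longrightarrow> \<phi> gs u = 0)"
  by (auto simp: hochschild_complex_def free_span_def fun_eq_iff)

lemma hochschild_scalar: "scalar (hochschild_complex G) c \<phi> gs u = c * \<phi> gs u"
  by (simp add: hochschild_complex_def)

lemma hochschild_scalar_vector_space:
  "vector_space (scalar (hochschild_complex G :: ('k::field, 'g list \<Rightarrow> 'g \<Rightarrow> 'k) cochain_cpx))"
  by (simp add: vector_space_def hochschild_scalar fun_eq_iff algebra_simps)

lemma conj_coords_add: "conj_coords G (\<phi> + \<psi>) = (\<lambda>y gs. conj_coords G \<phi> y gs + conj_coords G \<psi> y gs)"
  by (simp add: conj_coords_def fun_eq_iff)

lemma conj_coords_diff:
  fixes \<phi> :: "'g list \<Rightarrow> 'g \<Rightarrow> 'k::ab_group_add"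
  shows "conj_coords G (\<phi> - \<psi>) = (\<lambda>y gs. conj_coords G \<phi> y gs - conj_coords G \<psi> y gs)"
  by (simp add: conj_coords_def fun_eq_iff)

lemma conj_coords_scale:
  "conj_coords G (scalar (hochschild_complex G) c \<phi>) = (\<lambda>y gs. c * conj_coords G \<phi> y gs)"
  by (simp add: conj_coords_def hochschild_scalar fun_eq_iff)

lemma conj_coords_normalized:
  "\<phi> \<in> cochains (hochschild_complex G) n \<Longrightarrow> normalized G (conj_coords G \<phi> y)"
  by (auto simp: hochschild_cochains_iff normalized_def conj_coords_def tuples_def)

locale finite_group = group G for G :: "('g, 'm) monoid_scheme" (structure) +
  assumes finite_carrier: "finite (carrier G)"
begin

lemma ga_mult_basis_left:
  assumes "g \<in> carrier G" "u \<in> carrier G"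
  shows "ga_mult G (ga_basis g) b u = b (inv g \<otimes> u)"
proof -
  let ?A = "{(v, w). v \<in> carrier G \<and> w \<in> carrier G \<and> v \<otimes> w = u}"
  have fin: "finite ?A"
    by (rule finite_subset[of _ "carrier G \<times> carrier G"]) (use finite_carrier in auto)
  have "(\<Sum>(v, w)\<in>?A. ga_basis g v * b w) = (\<Sum>(v, w)\<in>{(g, inv g \<otimes> u)}. ga_basis g v * b w)"
    by (rule sum.mono_neutral_right[OF fin])
      (use assms in \<open>auto simp: ga_basis_def m_assoc[symmetric] split: if_splits\<close>)
  then show ?thesis by (simp add: ga_mult_def ga_basis_def)
qed

lemma ga_mult_basis_right:
  assumes "g \<in> carrier G" "u \<in> carrier G"
  shows "ga_mult G a (ga_basis g) u = a (u \<otimes> inv g)"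
proof -
  let ?A = "{(v, w). v \<in> carrier G \<and> w \<in> carrier G \<and> v \<otimes> w = u}"
  have fin: "finite ?A"
    by (rule finite_subset[of _ "carrier G \<times> carrier G"]) (use finite_carrier in auto)
  have "(\<Sum>(v, w)\<in>?A. a v * ga_basis g w) = (\<Sum>(v, w)\<in>{(u \<otimes> inv g, g)}. a v * ga_basis g w)"
    by (rule sum.mono_neutral_right[OF fin])
      (use assms in \<open>auto simp: ga_basis_def m_assoc split: if_splits\<close>)
  then show ?thesis by (simp add: ga_mult_def ga_basis_def)
qed

lemma ga_mult_outside:
  assumes "u \<notin> carrier G"
  shows "ga_mult G a b u = 0"
proof -
  have "{(v, w). v \<in> carrier G \<and> w \<in> carrier G \<and> v \<otimes> w = u} = {}" using assms by auto
  then show ?thesis unfolding ga_mult_def by (simp only: sum.empty)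
qed

lemma list_mult_append:
  assumes "set gs \<subseteq> carrier G" "set hs \<subseteq> carrier G"
  shows "list_mult G (gs @ hs) = list_mult G gs \<otimes> list_mult G hs"
  using assms(1)
proof (induction gs)
  case Nil
  then show ?case using list_mult_closed[OF is_group assms(2)] by (simp add: list_mult_def)
next
  case (Cons g gs)
  then show ?case
    using list_mult_closed[OF is_group assms(2)] list_mult_closed[OF is_group, of gs]
    by (simp add: list_mult_def m_assoc)
qed

lemma list_mult_Cons: "list_mult G (g # gs) = g \<otimes> list_mult G gs"
  by (simp add: list_mult_def)

lemma list_mult_Nil [simp]: "list_mult G [] = \<one>"
  by (simp add: list_mult_def)

lemma list_mult_in_carrier [simp]: "set gs \<subseteq> carrier G \<Longrightarrow> list_mult G gs \<in> carrier G"
  by (rule list_mult_closed[OF is_group])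

lemma list_mult_rev_inv:
  assumes "set gs \<subseteq> carrier G"
  shows "list_mult G (rev (map (m_inv G) gs)) = inv (list_mult G gs)"
  using assms
proof (induction gs)
  case (Cons g gs)
  have "set (rev (map (m_inv G) gs)) \<subseteq> carrier G" using Cons.prems by auto
  then show ?case
    using Cons by (simp add: list_mult_append list_mult_Cons inv_mult_group)
qed simp

text \<open>
  Merging neighbours does not change the product, hence not the coordinate \<open>y\<close>.
\<close>
lemma list_mult_merge_at:
  assumes "set gs \<subseteq> carrier G" "1 \<le> i" "i < length gs"
  shows "list_mult G (merge_at G i gs) = list_mult G gs"
proof -
  obtain j where i: "i = Suc j" using assms(2) by (cases i) auto
  define p q where "p = take j gs" and "q = drop (i + 1) gs"
  have gs: "gs = p @ gs ! j # gs ! i # q"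
    using assms(3) by (simp add: p_def q_def i Cons_nth_drop_Suc id_take_nth_drop[symmetric])
  have cl: "set p \<subseteq> carrier G" "set q \<subseteq> carrier G" "gs ! j \<in> carrier G" "gs ! i \<in> carrier G"
    using assms nth_mem[of j gs] nth_mem[of i gs] set_take_subset[of j gs] set_drop_subset[of "i + 1" gs]
    by (auto simp: p_def q_def i)
  have merge: "merge_at G i gs = p @ (gs ! j \<otimes> gs ! i) # q"
    by (simp add: merge_at_def p_def q_def i)
  have "list_mult G (merge_at G i gs) = list_mult G p \<otimes> (gs ! j \<otimes> gs ! i \<otimes> list_mult G q)"
    using cl by (simp add: merge list_mult_append list_mult_Cons)
  also have "\<dots> = list_mult G (p @ gs ! j # gs ! i # q)"
    using cl by (simp add: list_mult_append list_mult_Cons m_assoc)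
  finally show ?thesis using gs by simp
qed

sublocale conj: right_action G "carrier G" "conj_act G"
  by unfold_locales (simp_all add: inv_mult_group m_assoc)

lemma hochschild_cochain_eqI:
  assumes "\<phi> \<in> cochains (hochschild_complex G) n" "\<psi> \<in> cochains (hochschild_complex G) n"
    and "\<And>y gs. y \<in> carrier G \<Longrightarrow> gs \<in> tuples G n \<Longrightarrow> conj_coords G \<phi> y gs = conj_coords G \<psi> y gs"
  shows "\<phi> = \<psi>"
proof (intro ext)
  fix gs u
  show "\<phi> gs u = \<psi> gs u"
  proof (cases "gs \<in> tuples G n \<and> u \<in> carrier G")
    case True
    then have "set gs \<subseteq> carrier G" by (auto simp: tuples_def)
    then have "list_mult G gs \<in> carrier G" by simp
    then show ?thesis
      using True assms(3)[of "u \<otimes> inv (list_mult G gs)" gs] by (simp add: conj_coords_def m_assoc)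
  qed (use assms in \<open>auto simp: hochschild_cochains_iff\<close>)
qed

text \<open>
  The coefficient of \<open>y g\<^sub>1 \<cdots> g\<^sub>n\<^sub>+\<^sub>1\<close> in \<open>g\<^sub>1 \<phi>(g\<^sub>2, \<dots>)\<close> is that of
  \<open>(g\<^sub>1\<inverse> y g\<^sub>1) g\<^sub>2 \<cdots> g\<^sub>n\<^sub>+\<^sub>1\<close> in \<open>\<phi>(g\<^sub>2, \<dots>)\<close>; cancelling \<open>g\<^sub>n\<^sub>+\<^sub>1\<close> on the right in the last term leaves
  \<open>y\<close> unchanged.
\<close>
lemma hochschild_differential_coords:
  assumes \<phi>: "\<phi> \<in> cochains (hochschild_complex G) n"
    and gs: "set gs \<subseteq> carrier G" "length gs = Suc n" and y: "y \<in> carrier G"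
  shows "conj_coords G (differential (hochschild_complex G) n \<phi>) y gs =
    nerve_differential G (conj_act G) (conj_coords G \<phi>) y gs"
proof (cases "\<one> \<in> set gs")
  case True
  then have "gs \<notin> tuples G (n + 1)" by (auto simp: tuples_def)
  then show ?thesis
    using conj.nerve_differential_degenerate[of y gs "conj_coords G \<phi>"]
      True gs y conj_coords_normalized[OF \<phi>] by (simp add: hochschild_complex_def conj_coords_def)
next
  case False
  then have tup: "gs \<in> tuples G (n + 1)" using gs by (auto simp: tuples_def)
  define p where "p = list_mult G gs"
  have p: "p \<in> carrier G" using gs by (simp add: p_def)
  \<comment> \<open>The two outer faces split off the first and the last entry.\<close>
  obtain g r where r: "gs = g # r" using gs(2) by (cases gs) auto
  obtain b l where bl: "gs = b @ [l]" using gs(2) by (cases gs rule: rev_cases) auto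
  have "g \<in> carrier G" "set r \<subseteq> carrier G" using gs(1) unfolding r by auto
  moreover have "set b \<subseteq> carrier G" "l \<in> carrier G" using gs(1) unfolding bl by auto
  ultimately have cl: "g \<in> carrier G" "set r \<subseteq> carrier G" "set b \<subseteq> carrier G" "l \<in> carrier G" by blast+
  have "hd gs = g" "tl gs = r" by (simp_all add: r)
  moreover have "butlast gs = b" "last gs = l" by (simp_all add: bl)
  ultimately have ends: "hd gs = g" "tl gs = r" "butlast gs = b" "last gs = l" by blast+
  have first: "ga_mult G (ga_basis g) (\<phi> r) (y \<otimes> p) = conj_coords G \<phi> (conj_act G y g) r"
    using cl y p r
    by (simp add: ga_mult_basis_left conj_coords_def p_def list_mult_Cons m_assoc)
  have pb: "p = list_mult G b \<otimes> l"
    unfolding p_def bl using cl by (simp add: list_mult_append list_mult_Cons)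
  have last: "ga_mult G (\<phi> b) (ga_basis l) (y \<otimes> p) = conj_coords G \<phi> y b"
    using cl y p by (simp add: ga_mult_basis_right conj_coords_def pb m_assoc)
  have mid: "\<phi> (merge_at G i gs) (y \<otimes> p) = conj_coords G \<phi> y (merge_at G i gs)"
    if "i \<in> {1..n}" for i
    using list_mult_merge_at[OF gs(1), of i] that gs(2) by (simp add: conj_coords_def p_def)
  have "conj_coords G (differential (hochschild_complex G) n \<phi>) y gs =
      ga_mult G (ga_basis g) (\<phi> r) (y \<otimes> p) +
      (\<Sum>i=1..n. (- 1) ^ i * \<phi> (merge_at G i gs) (y \<otimes> p)) +
      (- 1) ^ (n + 1) * ga_mult G (\<phi> b) (ga_basis l) (y \<otimes> p)"
    using tup by (simp add: conj_coords_def hochschild_complex_def ends p_def)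
  also have "(\<Sum>i=1..n. (- 1) ^ i * \<phi> (merge_at G i gs) (y \<otimes> p)) =
      (\<Sum>i=1..n. (- 1) ^ i * conj_coords G \<phi> y (merge_at G i gs))"
    by (rule sum.cong) (simp_all only: mid)
  finally have "conj_coords G (differential (hochschild_complex G) n \<phi>) y gs =
      conj_coords G \<phi> (conj_act G y g) r + upper_faces G (conj_coords G \<phi> y) gs"
    unfolding first last upper_faces_eq_sum[OF gs(2)] ends(3) by (simp only: add.assoc)
  then show ?thesis by (simp add: r)
qed

lemma hochschild_differential_closed:
  assumes "\<phi> \<in> cochains (hochschild_complex G) n"
  shows "differential (hochschild_complex G) n \<phi> \<in> cochains (hochschild_complex G) (Suc n)"
proof -
  have "\<phi> gs u = 0" if "u \<notin> carrier G" for gs u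
    using assms that by (simp add: hochschild_cochains_iff)
  then show ?thesis
    unfolding hochschild_cochains_iff by (simp add: hochschild_complex_def ga_mult_outside)
qed

lemma hochschild_complex_is_complex:
  "cochain_complex (hochschild_complex G :: ('k::field, 'g list \<Rightarrow> 'g \<Rightarrow> 'k) cochain_cpx)"
proof -
  let ?C = "hochschild_complex G :: ('k, 'g list \<Rightarrow> 'g \<Rightarrow> 'k) cochain_cpx"
  interpret vector_space "scalar ?C" by (rule hochschild_scalar_vector_space)
  have sub: "subspace (cochains ?C n)" for n
    by (rule subspaceI) (simp_all add: hochschild_cochains_iff hochschild_scalar)
  note closed = hochschild_differential_closed
  have lin: "linear_from_to (scalar ?C) (cochains ?C n) (scalar ?C) (cochains ?C (n + 1)) (differential ?C n)" for n
    unfolding linear_from_to_def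
  proof (intro conjI ballI allI)
    show "differential ?C n \<in> cochains ?C n \<rightarrow> cochains ?C (n + 1)" using closed by auto
    show "differential ?C n (a + b) = differential ?C n a + differential ?C n b"
      if ab: "a \<in> cochains ?C n" "b \<in> cochains ?C n" for a b
    proof (rule hochschild_cochain_eqI)
      note s = subspace_add[OF sub ab]
      show "differential ?C n (a + b) \<in> cochains ?C (Suc n)"
        "differential ?C n a + differential ?C n b \<in> cochains ?C (Suc n)"
        using closed[OF s] closed[OF ab(1)] closed[OF ab(2)] subspace_add[OF sub] by auto
      fix y gs assume "y \<in> carrier G" "gs \<in> tuples G (Suc n)"
      then show "conj_coords G (differential ?C n (a + b)) y gs =
          conj_coords G (differential ?C n a + differential ?C n b) y gs"
        using tuplesD[of gs G "Suc n"]
        by (cases gs) (simp_all add: conj_coords_add hochschild_differential_coords[OF s]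
            hochschild_differential_coords[OF ab(1)] hochschild_differential_coords[OF ab(2)]
            upper_faces_add)
    qed
    show "differential ?C n (scalar ?C c a) = scalar ?C c (differential ?C n a)"
      if a: "a \<in> cochains ?C n" for c a
    proof (rule hochschild_cochain_eqI)
      note s = subspace_scale[OF sub a, of c]
      show "differential ?C n (scalar ?C c a) \<in> cochains ?C (Suc n)"
        "scalar ?C c (differential ?C n a) \<in> cochains ?C (Suc n)"
        using closed[OF s] subspace_scale[OF sub closed[OF a]] by auto
      fix y gs assume "y \<in> carrier G" "gs \<in> tuples G (Suc n)"
      then show "conj_coords G (differential ?C n (scalar ?C c a)) y gs =
          conj_coords G (scalar ?C c (differential ?C n a)) y gs"
        using tuplesD[of gs G "Suc n"]
        by (cases gs) (simp_all add: conj_coords_scale hochschild_differential_coords[OF s]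
            hochschild_differential_coords[OF a] upper_faces_cmult distrib_left)
    qed
  qed
  have "differential ?C (Suc n) (differential ?C n \<phi>) = 0"
    if \<phi>: "\<phi> \<in> cochains ?C n" for n \<phi>
  proof (rule hochschild_cochain_eqI)
    show "differential ?C (Suc n) (differential ?C n \<phi>) \<in> cochains ?C (Suc (Suc n))"
      by (intro closed \<phi>)
    show "0 \<in> cochains ?C (Suc (Suc n))" by (rule subspace_0[OF sub])
    fix y gs assume y: "y \<in> carrier G" and gs: "gs \<in> tuples G (Suc (Suc n))"
    have "conj_coords G (differential ?C (Suc n) (differential ?C n \<phi>)) y gs =
        nerve_differential G (conj_act G) (conj_coords G (differential ?C n \<phi>)) y gs"
      by (rule hochschild_differential_coords[OF closed[OF \<phi>] tuplesD[OF gs] y])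
    also have "\<dots> = nerve_differential G (conj_act G)
        (nerve_differential G (conj_act G) (conj_coords G \<phi>)) y gs"
      by (rule conj.nerve_differential_cong)
        (use tuplesD[OF gs] y in \<open>simp_all add: hochschild_differential_coords[OF \<phi>]\<close>)
    also have "\<dots> = 0" by (rule conj.nerve_differential_squared) (use tuplesD[OF gs] y in auto)
    finally show "conj_coords G (differential ?C (Suc n) (differential ?C n \<phi>)) y gs =
        conj_coords G 0 y gs" by (simp add: conj_coords_def)
  qed
  then show ?thesis
    using sub lin vector_space_axioms by (simp add: cochain_complex_def)
qed

end

section \<open>Cohomology of a deformation retract onto a direct sum\<close>

definition additive_subgroup :: "'a::ab_group_add set \<Rightarrow> bool" where
  "additive_subgroup B \<longleftrightarrow> 0 \<in> B \<and> (\<forall>a\<in>B. \<forall>b\<in>B. a + b \<in> B) \<and> (\<forall>a\<in>B. - a \<in> B)"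

lemma coset_eqI:
  assumes "additive_subgroup B" "a - b \<in> B"
  shows "{a} + B = {b::'a::ab_group_add} + B"
proof -
  have sub: "{c} + B \<subseteq> {d} + B" if "c - d \<in> B" for c d :: 'a
  proof
    fix u assume "u \<in> {c} + B"
    then obtain v where "v \<in> B" "u = d + ((c - d) + v)" by (auto simp: set_plus_def algebra_simps)
    moreover have "(c - d) + v \<in> B"
      using assms(1) that \<open>v \<in> B\<close> by (simp add: additive_subgroup_def)
    ultimately show "u \<in> {d} + B" unfolding set_plus_def by blast
  qed
  have "b - a \<in> B" using assms by (metis additive_subgroup_def minus_diff_eq)
  then show ?thesis using sub assms(2) by blast
qed

lemma subgroup_plus_self: "additive_subgroup B \<Longrightarrow> B + B = B"
  by (force simp: additive_subgroup_def set_plus_def)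

lemma coset_add:
  assumes "additive_subgroup B"
  shows "({a} + B) + ({b} + B) = {a + b} + B"
proof -
  have "({a} + B) + ({b} + B) = ({a} + {b}) + (B + B)" by (simp only: ac_simps)
  moreover have "{a} + {b} = {a + b}" by (auto simp: set_plus_def)
  ultimately show ?thesis by (simp only: subgroup_plus_self[OF assms])
qed

lemma coset_sum:
  assumes "additive_subgroup B" "finite I" "I \<noteq> {}"
  shows "(\<Sum>i\<in>I. {z i} + B) = {\<Sum>i\<in>I. z i} + B"
  using assms(2,3) by (induction I rule: finite_ne_induct) (simp_all add: coset_add[OF assms(1)])

text \<open>
  Both the map induced on classes and the scalar multiplication of classes have the form
  \<open>K \<mapsto> f ` K + B'\<close>.  This computes them on the class of a representative.
\<close>
lemma coset_image:
  assumes "additive_subgroup B" "additive_subgroup B'"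
    and "\<And>b. b \<in> B \<Longrightarrow> f (z + b) = f z + f b" "\<And>b. b \<in> B \<Longrightarrow> f b \<in> B'"
  shows "f ` ({z} + B) + B' = {f z} + B'"
proof
  show "f ` ({z} + B) + B' \<subseteq> {f z} + B'"
  proof
    fix u assume "u \<in> f ` ({z} + B) + B'"
    then obtain b b' where b: "b \<in> B" "b' \<in> B'" "u = f (z + b) + b'"
      by (auto simp: set_plus_def)
    then have "u = f z + (f b + b')" "f b + b' \<in> B'"
      using assms by (auto simp: additive_subgroup_def add.assoc)
    then show "u \<in> {f z} + B'" by (auto simp: set_plus_def)
  qed
  have "z + 0 \<in> {z} + B" using assms(1) unfolding additive_subgroup_def set_plus_def by blast
  then show "{f z} + B' \<subseteq> f ` ({z} + B) + B'"
    by (intro set_plus_mono2) auto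
qed

lemma linear_from_toD:
  assumes "linear_from_to sA A sB B f"
  shows "a \<in> A \<Longrightarrow> f a \<in> B" "a \<in> A \<Longrightarrow> b \<in> A \<Longrightarrow> f (a + b) = f a + f b"
    and "a \<in> A \<Longrightarrow> f (sA c a) = sB c (f a)"
  using assms by (auto simp: linear_from_to_def)

lemma linear_from_to_zero:
  assumes "linear_from_to sA A sB B f" "0 \<in> A"
  shows "f 0 = 0"
  using linear_from_toD(2)[OF assms(1) assms(2,2)] by simp

locale differential_complex =
  fixes C :: "('k::field, 'a::ab_group_add) cochain_cpx"
  assumes is_complex: "cochain_complex C"
begin

sublocale vs: vector_space "scalar C"
  using is_complex by (simp add: cochain_complex_def)

lemma cochains_subspace: "vs.subspace (cochains C n)"
  using is_complex by (simp add: cochain_complex_def)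

lemma differential_linear:
  "linear_from_to (scalar C) (cochains C n) (scalar C) (cochains C (Suc n)) (differential C n)"
  using is_complex by (simp add: cochain_complex_def)

lemma differential_squared: "a \<in> cochains C n \<Longrightarrow> differential C (Suc n) (differential C n a) = 0"
  using is_complex by (simp add: cochain_complex_def)

lemma subspace_additive: "vs.subspace B \<Longrightarrow> additive_subgroup B"
  unfolding additive_subgroup_def
  by (meson vs.subspace_0 vs.subspace_add vs.subspace_neg)

lemma cocycles_subspace: "vs.subspace (cocycles C n)"
proof (rule vs.subspaceI)
  note d = linear_from_toD[OF differential_linear[of n]]
  show "0 \<in> cocycles C n"
    using linear_from_to_zero[OF differential_linear[of n]] vs.subspace_0[OF cochains_subspace]
    by (simp add: cocycles_def)
  show "a + b \<in> cocycles C n" if "a \<in> cocycles C n" "b \<in> cocycles C n" for a b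
    using that d(2) vs.subspace_add[OF cochains_subspace] by (auto simp: cocycles_def)
  show "scalar C c a \<in> cocycles C n" if "a \<in> cocycles C n" for c a
    using that d(3) vs.subspace_scale[OF cochains_subspace] by (auto simp: cocycles_def)
qed

lemma coboundaries_subspace: "vs.subspace (coboundaries C n)"
proof (cases n)
  case (Suc m)
  note lin = differential_linear[of m] and sub = cochains_subspace[of m]
  note d = linear_from_toD[OF lin]
  show ?thesis
  proof (rule vs.subspaceI)
    show "0 \<in> coboundaries C n"
      using linear_from_to_zero[OF lin] vs.subspace_0[OF sub] Suc by (force simp: coboundaries_def)
    show "a + b \<in> coboundaries C n" if ab: "a \<in> coboundaries C n" "b \<in> coboundaries C n" for a b
    proof -
      obtain a' b' where "a' \<in> cochains C m" "b' \<in> cochains C m"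
        "a = differential C m a'" "b = differential C m b'"
        using ab Suc by (auto simp: coboundaries_def)
      then have "a + b = differential C m (a' + b')" "a' + b' \<in> cochains C m"
        using d(2) vs.subspace_add[OF sub] by auto
      then show ?thesis using Suc by (simp add: coboundaries_def)
    qed
    show "scalar C c a \<in> coboundaries C n" if a: "a \<in> coboundaries C n" for c a
    proof -
      obtain a' where "a' \<in> cochains C m" "a = differential C m a'"
        using a Suc by (auto simp: coboundaries_def)
      then have "scalar C c a = differential C m (scalar C c a')" "scalar C c a' \<in> cochains C m"
        using d(3) vs.subspace_scale[OF sub] by auto
      then show ?thesis using Suc by (simp add: coboundaries_def)
    qed
  qed
qed (simp add: coboundaries_def vs.subspace_single_0)

lemma coboundaries_cocycles: "coboundaries C n \<subseteq> cocycles C n"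
proof (cases n)
  case 0
  then show ?thesis using vs.subspace_0[OF cocycles_subspace] by (simp add: coboundaries_def)
next
  case (Suc m)
  then show ?thesis
    using linear_from_toD(1)[OF differential_linear[of m]] differential_squared
    by (auto simp: coboundaries_def cocycles_def)
qed

lemmas coboundaries_additive = subspace_additive[OF coboundaries_subspace]

lemma class_scale_coset:
  "class_scale C n c ({z} + coboundaries C n) = {scalar C c z} + coboundaries C n"
  unfolding class_scale_def
  by (rule coset_image[OF coboundaries_additive coboundaries_additive])
     (simp_all add: vs.scale_right_distrib vs.subspace_scale[OF coboundaries_subspace])

end

lemma cochain_map_cocycle:
  assumes "cochain_complex C" "cochain_complex D" "cochain_map C D f" "z \<in> cocycles C n"
  shows "f n z \<in> cocycles D n"
proof -
  interpret C: differential_complex C by (simp add: differential_complex_def assms)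
  interpret D: differential_complex D by (simp add: differential_complex_def assms)
  have lin: "linear_from_to (scalar C) (cochains C m) (scalar D) (cochains D m) (f m)" for m
    using assms(3) by (simp add: cochain_map_def)
  have "f (Suc n) (differential C n z) = differential D n (f n z)"
  proof -
    have "\<forall>a\<in>cochains C n. f (n + 1) (differential C n a) = differential D n (f n a)"
      using assms(3) unfolding cochain_map_def by blast
    moreover have "z \<in> cochains C n" "differential C n z = 0" using assms(4) by (simp_all add: cocycles_def)
    ultimately show ?thesis by fastforce
  qed
  moreover have "f (Suc n) 0 = 0"
    using linear_from_to_zero[OF lin] C.vs.subspace_0[OF C.cochains_subspace] by blast
  ultimately show ?thesis
    using assms(4) linear_from_toD(1)[OF lin] by (simp add: cocycles_def)
qed

lemma cochain_map_coboundary: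
  assumes "cochain_complex C" "cochain_complex D" "cochain_map C D f" "b \<in> coboundaries C n"
  shows "f n b \<in> coboundaries D n"
proof -
  interpret C: differential_complex C by (simp add: differential_complex_def assms)
  have lin: "linear_from_to (scalar C) (cochains C m) (scalar D) (cochains D m) (f m)" for m
    using assms(3) by (simp add: cochain_map_def)
  show ?thesis
  proof (cases n)
    case 0
    then show ?thesis
      using assms(4) linear_from_to_zero[OF lin C.vs.subspace_0[OF C.cochains_subspace]]
      by (simp add: coboundaries_def)
  next
    case (Suc m)
    then obtain a where a: "a \<in> cochains C m" "b = differential C m a"
      using assms(4) by (auto simp: coboundaries_def)
    then have "f n b = differential D m (f m a)"
      using assms(3) Suc by (simp add: cochain_map_def)
    then show ?thesis using Suc linear_from_toD(1)[OF lin a(1)] by (simp add: coboundaries_def)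
  qed
qed

lemma induced_map_coset:
  assumes "cochain_complex C" "cochain_complex D" "cochain_map C D f" "z \<in> cocycles C n"
  shows "induced_map D n (f n) ({z} + coboundaries C n) = {f n z} + coboundaries D n"
proof -
  interpret C: differential_complex C by (simp add: differential_complex_def assms)
  interpret D: differential_complex D by (simp add: differential_complex_def assms)
  have lin: "linear_from_to (scalar C) (cochains C n) (scalar D) (cochains D n) (f n)"
    using assms(3) by (simp add: cochain_map_def)
  show ?thesis
    unfolding induced_map_def
  proof (rule coset_image[OF C.coboundaries_additive D.coboundaries_additive])
    fix b assume b: "b \<in> coboundaries C n"
    show "f n b \<in> coboundaries D n" by (rule cochain_map_coboundary[OF assms(1-3) b])
    show "f n (z + b) = f n z + f n b"
      using linear_from_toD(2)[OF lin] b C.coboundaries_cocycles[of n] assms(4)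
      by (auto simp: cocycles_def)
  qed
qed

lemma direct_sum_cochains_iff:
  assumes "finite I"
  shows "a \<in> cochains (direct_sum_complex I D) n \<longleftrightarrow>
    (\<forall>i\<in>I. a i \<in> cochains (D i) n) \<and> (\<forall>i. i \<notin> I \<longrightarrow> a i = 0)"
proof -
  have "finite {i. a i \<noteq> 0}" if "\<forall>i. i \<notin> I \<longrightarrow> a i = 0"
    by (rule finite_subset[OF _ assms]) (use that in auto)
  then show ?thesis by (auto simp: direct_sum_complex_def)
qed

lemma direct_sum_scalar: "scalar (direct_sum_complex I D) c a i = scalar (D i) c (a i)"
  by (simp add: direct_sum_complex_def)

lemma direct_sum_differential:
  "differential (direct_sum_complex I D) n a i = (if i \<in> I then differential (D i) n (a i) else 0)"
  by (simp add: direct_sum_complex_def)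

lemma direct_sum_complex_is_complex:
  fixes D :: "'i \<Rightarrow> ('k::field, 'b::ab_group_add) cochain_cpx"
  assumes fin: "finite I"
    and vs: "\<And>i. vector_space (scalar (D i))"
    and cpx: "\<And>i. i \<in> I \<Longrightarrow> cochain_complex (D i)"
  shows "cochain_complex (direct_sum_complex I D)"
proof -
  let ?S = "direct_sum_complex I D"
  note chains = direct_sum_cochains_iff[OF fin, of _ D]
  note scale = direct_sum_scalar[of I D] and diff = direct_sum_differential[of I D]
  have D: "differential_complex (D i)" if "i \<in> I" for i
    using cpx[OF that] by (simp add: differential_complex_def)
  have zero: "scalar (D i) c 0 = 0" for i c
  proof -
    interpret vector_space "scalar (D i)" by (rule vs)
    show ?thesis by simp
  qed
  have V: "vector_space (scalar ?S)"
    using vs by (simp add: vector_space_def scale fun_eq_iff)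
  interpret S: vector_space "scalar ?S" by (rule V)
  have comp: "0 \<in> cochains (D i) n"
    "a \<in> cochains (D i) n \<Longrightarrow> b \<in> cochains (D i) n \<Longrightarrow> a + b \<in> cochains (D i) n"
    "a \<in> cochains (D i) n \<Longrightarrow> scalar (D i) c a \<in> cochains (D i) n" if "i \<in> I" for i n a b c
  proof -
    interpret differential_complex "D i" by (rule D[OF that])
    note sub = cochains_subspace[of n]
    show "0 \<in> cochains (D i) n" by (rule vs.subspace_0[OF sub])
    show "a + b \<in> cochains (D i) n" if "a \<in> cochains (D i) n" "b \<in> cochains (D i) n"
      by (rule vs.subspace_add[OF sub that])
    show "scalar (D i) c a \<in> cochains (D i) n" if "a \<in> cochains (D i) n"
      by (rule vs.subspace_scale[OF sub that])
  qed
  have sub: "S.subspace (cochains ?S n)" for n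
    by (rule S.subspaceI) (simp_all add: chains comp scale zero)
  have lin: "linear_from_to (scalar ?S) (cochains ?S n) (scalar ?S) (cochains ?S (n + 1)) (differential ?S n)"
    for n
  proof -
    note d = linear_from_toD[OF differential_complex.differential_linear[OF D]]
    show ?thesis
      unfolding linear_from_to_def Pi_iff chains
      by (intro conjI ballI allI impI ext) (simp_all add: diff scale chains d zero)
  qed
  have "differential ?S (n + 1) (differential ?S n a) = 0" if "a \<in> cochains ?S n" for n a
    using that differential_complex.differential_squared[OF D] by (auto simp: diff chains fun_eq_iff)
  then show ?thesis using V sub lin by (simp add: cochain_complex_def)
qed

lemma direct_sum_map_component:
  assumes "i \<in> I" "finite I" "cochain_map C (direct_sum_complex I D) f"
  shows "cochain_map C (D i) (\<lambda>n a. f n a i)"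
  using assms
  unfolding cochain_map_def linear_from_to_def Pi_iff direct_sum_cochains_iff[OF assms(2)]
  by (auto simp: fun_eq_iff direct_sum_scalar direct_sum_differential)

text \<open>
  Each summand embeds into the direct sum, and the component of \<open>f\<close> is the composite with this embedding.
\<close>
lemma sum_map_component:
  fixes C :: "('k::field, 'a::ab_group_add) cochain_cpx"
    and D :: "'i \<Rightarrow> ('k, 'b::ab_group_add) cochain_cpx"
  assumes i: "i \<in> I" and fin: "finite I"
    and vs: "\<And>i. vector_space (scalar (D i))"
    and cpx: "\<And>i. i \<in> I \<Longrightarrow> cochain_complex (D i)"
    and f: "cochain_map (direct_sum_complex I D) C f"
    and r: "\<And>n b. b \<in> cochains (direct_sum_complex I D) n \<Longrightarrow> f n b = (\<Sum>i\<in>I. r i n (b i))"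
    and r0: "\<And>i n. i \<in> I \<Longrightarrow> r i n 0 = 0"
  shows "cochain_map (D i) C (r i)"
proof -
  let ?S = "direct_sum_complex I D"
  define single where "single b = (\<lambda>j. if j = i then b else 0)" for b :: 'b
  have D: "differential_complex (D j)" if "j \<in> I" for j
    using cpx[OF that] by (simp add: differential_complex_def)
  have zero: "scalar (D j) c 0 = 0" for j c
  proof -
    interpret vector_space "scalar (D j)" by (rule vs)
    show ?thesis by simp
  qed
  have zero_cochain: "0 \<in> cochains (D j) n" if "j \<in> I" for j n
  proof -
    interpret differential_complex "D j" by (rule D[OF that])
    show ?thesis by (rule vs.subspace_0[OF cochains_subspace])
  qed
  have d0: "differential (D j) n 0 = 0" if "j \<in> I" for j n
    by (rule linear_from_to_zero[OF differential_complex.differential_linear[OF D[OF that]] zero_cochain[OF that]])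
  have single: "single b \<in> cochains ?S n" if "b \<in> cochains (D i) n" for b n
    using that zero_cochain i by (auto simp: direct_sum_cochains_iff[OF fin] single_def)
  have r_eq: "r i n b = f n (single b)" if "b \<in> cochains (D i) n" for b n
  proof -
    have "f n (single b) = (\<Sum>j\<in>I. if j = i then r i n b else 0)"
      unfolding r[OF single[OF that]] by (rule sum.cong) (auto simp: single_def r0)
    then show ?thesis using i fin by simp
  qed
  have lin: "linear_from_to (scalar ?S) (cochains ?S n) (scalar C) (cochains C n) (f n)" for n
    using f by (simp add: cochain_map_def)
  interpret Di: differential_complex "D i" by (rule D[OF i])
  have add: "a + b \<in> cochains (D i) n" if "a \<in> cochains (D i) n" "b \<in> cochains (D i) n" for a b n
    by (rule Di.vs.subspace_add[OF Di.cochains_subspace that])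
  have scale: "scalar (D i) c a \<in> cochains (D i) n" if "a \<in> cochains (D i) n" for a c n
    by (rule Di.vs.subspace_scale[OF Di.cochains_subspace that])
  have single_add: "single (a + b) = single a + single b" for a b
    by (auto simp: single_def)
  have single_scale: "single (scalar (D i) c a) = scalar ?S c (single a)" for a c
    by (rule ext) (auto simp: single_def direct_sum_scalar zero)
  have single_d: "single (differential (D i) n a) = differential ?S n (single a)" for a n
    by (rule ext) (use i in \<open>auto simp: single_def direct_sum_differential d0\<close>)
  have comm: "f (n + 1) (differential ?S n b) = differential C n (f n b)" if "b \<in> cochains ?S n" for n b
    using f that by (simp add: cochain_map_def)
  show ?thesis
    unfolding cochain_map_def
  proof (intro conjI allI ballI)
    fix n
    show "linear_from_to (scalar (D i)) (cochains (D i) n) (scalar C) (cochains C n) (r i n)"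
      unfolding linear_from_to_def Pi_iff
      using linear_from_toD[OF lin] by (auto simp: r_eq add scale single single_add single_scale)
    fix a assume a: "a \<in> cochains (D i) n"
    then have "differential (D i) n a \<in> cochains (D i) (n + 1)"
      using linear_from_toD(1)[OF Di.differential_linear] by simp
    then show "r i (n + 1) (differential (D i) n a) = differential C n (r i n a)"
      using comm[OF single[OF a]] a by (simp add: r_eq single_d)
  qed
qed

text \<open>
  On classes of cocycles \<open>F\<close> and \<open>R\<close> act through \<open>\<iota>\<close> and \<open>\<rho>\<close> on representatives.  Then
  \<open>F \<circ> R = id\<close> follows from \<open>\<iota> \<circ> \<rho> = id\<close>, and \<open>R \<circ> F = id\<close> holds because on a cocycle the homotopy
  identity reduces to \<open>z - \<rho> (\<iota> z) = \<delta> (s z)\<close>.  The index set must be nonempty, as an empty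
  sum of classes is the set \<open>{0}\<close> and not the class of coboundaries.
\<close>
lemma retract_onto_direct_sum_cohomology:
  fixes C :: "('k::field, 'a::ab_group_add) cochain_cpx"
    and D :: "'i \<Rightarrow> ('k, 'b::ab_group_add) cochain_cpx"
  assumes fin: "finite I" and ne: "I \<noteq> {}"
    and vs: "\<And>i. vector_space (scalar (D i))"
    and cpx: "\<And>i. i \<in> I \<Longrightarrow> cochain_complex (D i)"
    and retract: "homotopy_deformation_retract C (direct_sum_complex I D) \<iota> \<rho> s"
    and r: "\<And>n b. b \<in> cochains (direct_sum_complex I D) n \<Longrightarrow> \<rho> n b = (\<Sum>i\<in>I. r i n (b i))"
    and r0: "\<And>i n. i \<in> I \<Longrightarrow> r i n 0 = 0"
  shows "induce_inverse_cohomology_isos C I D n (\<lambda>i a. \<iota> n a i) (\<lambda>i. r i n)"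
proof -
  let ?S = "direct_sum_complex I D"
  let ?B = "coboundaries C n" and ?BD = "\<lambda>i. coboundaries (D i) n"
  have C: "cochain_complex C" and \<iota>: "cochain_map C ?S \<iota>" and \<rho>: "cochain_map ?S C \<rho>"
    and hom: "\<And>n. linear_from_to (scalar C) (cochains C (n + 1)) (scalar C) (cochains C n) (s (n + 1))"
    and retr: "\<And>n b. b \<in> cochains ?S n \<Longrightarrow> \<iota> n (\<rho> n b) = b"
    and homotopy: "\<And>n a. a \<in> cochains C n \<Longrightarrow> a - \<rho> n (\<iota> n a) =
        (if n = 0 then 0 else differential C (n - 1) (s n a)) + s (n + 1) (differential C n a)"
    using retract unfolding homotopy_deformation_retract_def by blast+
  interpret C: differential_complex C by (simp add: differential_complex_def C)
  have D: "differential_complex (D i)" if "i \<in> I" for i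
    using cpx[OF that] by (simp add: differential_complex_def)
  note \<iota>i = direct_sum_map_component[OF _ fin \<iota>]
  note ri = sum_map_component[OF _ fin vs cpx \<rho> r r0]
  define F where "F = (\<lambda>K. \<lambda>i\<in>I. induced_map (D i) n (\<lambda>a. \<iota> n a i) K)"
  define R where "R = (\<lambda>L. \<Sum>i\<in>I. induced_map C n (r i n) (L i))"
  define S where "S = (\<Pi>\<^sub>E i\<in>I. cohomology (D i) n)"
  have F_class: "F ({z} + ?B) = (\<lambda>i\<in>I. {\<iota> n z i} + ?BD i)" if "z \<in> cocycles C n" for z
    unfolding F_def by (rule restrict_ext) (rule induced_map_coset[OF C cpx \<iota>i that])
  have \<iota>_cocycle: "\<iota> n z i \<in> cocycles (D i) n" if "z \<in> cocycles C n" "i \<in> I" for z i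
    by (rule cochain_map_cocycle[OF C cpx \<iota>i that(1)]) (use that in auto)
  have R_class: "R (\<lambda>i\<in>I. {z i} + ?BD i) = {\<Sum>i\<in>I. r i n (z i)} + ?B"
    if "\<And>i. i \<in> I \<Longrightarrow> z i \<in> cocycles (D i) n" for z
  proof -
    have "R (\<lambda>i\<in>I. {z i} + ?BD i) = (\<Sum>i\<in>I. {r i n (z i)} + ?B)"
      unfolding R_def by (rule sum.cong) (use that in \<open>simp_all add: induced_map_coset[OF cpx C ri]\<close>)
    then show ?thesis by (simp add: coset_sum[OF C.coboundaries_additive fin ne])
  qed
  have S_elem: "\<exists>z. (\<forall>i\<in>I. z i \<in> cocycles (D i) n) \<and> (\<forall>i. i \<notin> I \<longrightarrow> z i = 0) \<and>
      L = (\<lambda>i\<in>I. {z i} + ?BD i)" if L: "L \<in> S" for L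
  proof -
    have "\<forall>i\<in>I. \<exists>w. w \<in> cocycles (D i) n \<and> L i = {w} + ?BD i"
      using L unfolding S_def cohomology_def by (auto dest: PiE_mem)
    then obtain w where w: "\<And>i. i \<in> I \<Longrightarrow> w i \<in> cocycles (D i) n \<and> L i = {w i} + ?BD i"
      by metis
    have "L = (\<lambda>i\<in>I. {w i} + ?BD i)"
      using L w unfolding S_def by (intro ext) (auto simp: PiE_def extensional_def)
    also have "\<dots> = (\<lambda>i\<in>I. {if i \<in> I then w i else 0} + ?BD i)" by (intro restrict_ext) simp
    finally show ?thesis using w by (intro exI[of _ "\<lambda>i. if i \<in> I then w i else 0"]) auto
  qed
  have r_cocycle: "(\<Sum>i\<in>I. r i n (z i)) \<in> cocycles C n"
    if "\<And>i. i \<in> I \<Longrightarrow> z i \<in> cocycles (D i) n" for z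
    by (rule C.vs.subspace_sum[OF C.cocycles_subspace])
       (rule cochain_map_cocycle[OF cpx C ri that])
  have RF: "R (F K) = K" if K: "K \<in> cohomology C n" for K
  proof -
    obtain z where z: "z \<in> cocycles C n" "K = {z} + ?B" using K by (auto simp: cohomology_def)
    then have zc: "z \<in> cochains C n" by (simp add: cocycles_def)
    have "\<iota> n z \<in> cochains ?S n"
      using \<iota> linear_from_toD(1) zc unfolding cochain_map_def by blast
    then have "R (F K) = {\<rho> n (\<iota> n z)} + ?B"
      using z by (simp add: F_class R_class \<iota>_cocycle r)
    also have "\<dots> = {z} + ?B"
    proof (rule coset_eqI[OF C.coboundaries_additive, symmetric])
      have "s (n + 1) 0 = 0"
        by (rule linear_from_to_zero[OF hom]) (rule C.vs.subspace_0[OF C.cochains_subspace])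
      then have eq: "z - \<rho> n (\<iota> n z) = (if n = 0 then 0 else differential C (n - 1) (s n z))"
        using homotopy[OF zc] z(1) by (simp add: cocycles_def)
      show "z - \<rho> n (\<iota> n z) \<in> ?B"
      proof (cases n)
        case (Suc m)
        then have "s n z \<in> cochains C m" using linear_from_toD(1)[OF hom[of m]] zc by simp
        then show ?thesis using eq Suc by (simp add: coboundaries_def)
      qed (use eq in \<open>simp add: coboundaries_def\<close>)
    qed
    finally show ?thesis using z(2) by simp
  qed
  have FR: "F (R L) = L" if L: "L \<in> S" for L
  proof -
    obtain z where z: "\<forall>i\<in>I. z i \<in> cocycles (D i) n" "\<forall>i. i \<notin> I \<longrightarrow> z i = 0"
      "L = (\<lambda>i\<in>I. {z i} + ?BD i)" using S_elem[OF L] by blast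
    have zS: "z \<in> cochains ?S n"
      using z by (simp add: direct_sum_cochains_iff[OF fin] cocycles_def)
    have "F (R L) = (\<lambda>i\<in>I. {\<iota> n (\<rho> n z) i} + ?BD i)"
      using z r_cocycle[of z] by (simp add: R_class F_class r[OF zS])
    then show ?thesis using z(3) retr[OF zS] by simp
  qed
  have F_in: "F K \<in> S" if "K \<in> cohomology C n" for K
    using that \<iota>_cocycle unfolding S_def by (auto simp: cohomology_def F_class)
  have R_in: "R L \<in> cohomology C n" if L: "L \<in> S" for L
  proof -
    obtain z where "\<forall>i\<in>I. z i \<in> cocycles (D i) n" "L = (\<lambda>i\<in>I. {z i} + ?BD i)"
      using S_elem[OF L] by blast
    then show ?thesis using r_cocycle[of z] by (auto simp: R_class cohomology_def)
  qed
  have bij: "bij_betw F (cohomology C n) S"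
    by (rule bij_betw_byWitness[where f' = R]) (use RF FR F_in R_in in auto)
  have \<iota>_lin: "linear_from_to (scalar C) (cochains C n) (scalar (D i)) (cochains (D i) n) (\<lambda>a. \<iota> n a i)"
    if "i \<in> I" for i using \<iota>i[OF that] by (simp add: cochain_map_def)
  have F_add: "F (K + L) = (\<lambda>i\<in>I. F K i + F L i)"
    if K: "K \<in> cohomology C n" and L: "L \<in> cohomology C n" for K L
  proof -
    obtain z w where z: "z \<in> cocycles C n" "K = {z} + ?B" and w: "w \<in> cocycles C n" "L = {w} + ?B"
      using K L by (auto simp: cohomology_def)
    have "K + L = {z + w} + ?B" unfolding z(2) w(2) by (rule coset_add[OF C.coboundaries_additive])
    moreover have "z + w \<in> cocycles C n" by (rule C.vs.subspace_add[OF C.cocycles_subspace z(1) w(1)])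
    ultimately have "F (K + L) = (\<lambda>i\<in>I. {\<iota> n (z + w) i} + ?BD i)" by (simp add: F_class)
    also have "\<dots> = (\<lambda>i\<in>I. F K i + F L i)"
    proof (rule restrict_ext)
      fix i assume i: "i \<in> I"
      have "\<iota> n (z + w) i = \<iota> n z i + \<iota> n w i"
        using linear_from_toD(2)[OF \<iota>_lin[OF i]] z(1) w(1) by (simp add: cocycles_def)
      then show "{\<iota> n (z + w) i} + ?BD i = F K i + F L i"
        using i z w coset_add[OF differential_complex.coboundaries_additive[OF D[OF i]]] by (simp add: F_class)
    qed
    finally show ?thesis .
  qed
  have F_scale: "F (class_scale C n c K) = (\<lambda>i\<in>I. class_scale (D i) n c (F K i))"
    if K: "K \<in> cohomology C n" for c K
  proof -
    obtain z where z: "z \<in> cocycles C n" "K = {z} + ?B" using K by (auto simp: cohomology_def)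
    have "scalar C c z \<in> cocycles C n" by (rule C.vs.subspace_scale[OF C.cocycles_subspace z(1)])
    then have "F (class_scale C n c K) = (\<lambda>i\<in>I. {\<iota> n (scalar C c z) i} + ?BD i)"
      unfolding z(2) C.class_scale_coset by (simp add: F_class)
    also have "\<dots> = (\<lambda>i\<in>I. class_scale (D i) n c (F K i))"
    proof (rule restrict_ext)
      fix i assume i: "i \<in> I"
      have "\<iota> n (scalar C c z) i = scalar (D i) c (\<iota> n z i)"
        using linear_from_toD(3)[OF \<iota>_lin[OF i]] z(1) by (simp add: cocycles_def)
      then show "{\<iota> n (scalar C c z) i} + ?BD i = class_scale (D i) n c (F K i)"
        using i z differential_complex.class_scale_coset[OF D[OF i]] by (simp add: F_class)
    qed
    finally show ?thesis .
  qed
  show ?thesis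
    unfolding induce_inverse_cohomology_isos_def Let_def
    using bij F_add F_scale RF FR unfolding F_def R_def S_def by blast
qed

section \<open>Centralizers\<close>

context group
begin

lemma centralizerI: "h \<in> carrier G \<Longrightarrow> h \<otimes> x = x \<otimes> h \<Longrightarrow> h \<in> centralizer G x"
  by (simp only: centralizer_def mem_Collect_eq)

lemma centralizerD:
  assumes "h \<in> centralizer G x"
  shows "h \<in> carrier G" "h \<otimes> x = x \<otimes> h"
  using assms unfolding centralizer_def mem_Collect_eq by blast+

lemma centralizer_subgroup:
  assumes x: "x \<in> carrier G"
  shows "subgroup (centralizer G x) G"
proof (rule subgroupI)
  show "centralizer G x \<subseteq> carrier G" using centralizerD(1) by blast
  show "centralizer G x \<noteq> {}" using centralizerI[OF x refl] by blast
  fix a assume a: "a \<in> centralizer G x"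
  note aD = centralizerD[OF a]
  have "inv a \<otimes> x = inv a \<otimes> (x \<otimes> a) \<otimes> inv a" using aD(1) x by (simp add: m_assoc)
  also have "\<dots> = x \<otimes> inv a"
    unfolding aD(2)[symmetric] using aD(1) x by (simp add: m_assoc[symmetric])
  finally show "inv a \<in> centralizer G x" by (rule centralizerI[OF inv_closed[OF aD(1)]])
  fix b assume b: "b \<in> centralizer G x"
  note bD = centralizerD[OF b]
  have "a \<otimes> b \<otimes> x = a \<otimes> (x \<otimes> b)" using aD(1) bD(1) x by (simp only: m_assoc bD(2))
  also have "\<dots> = (x \<otimes> a) \<otimes> b" using aD(1) bD(1) x by (simp only: m_assoc[symmetric] aD(2))
  also have "\<dots> = x \<otimes> (a \<otimes> b)" using aD(1) bD(1) x by (simp only: m_assoc)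
  finally show "a \<otimes> b \<in> centralizer G x" by (rule centralizerI[OF m_closed[OF aD(1) bD(1)]])
qed

lemma conj_act_centralizer:
  assumes "x \<in> carrier G" "h \<in> centralizer G x"
  shows "conj_act G x h = x"
proof -
  note h = centralizerD[OF assms(2)]
  have "conj_act G x h = inv h \<otimes> (h \<otimes> x)" unfolding h(2) using h(1) assms(1) by (simp add: m_assoc)
  also have "\<dots> = x" using h(1) assms(1) by (simp add: m_assoc[symmetric])
  finally show ?thesis .
qed

lemma centralizer_carrier: "set hs \<subseteq> centralizer G x \<Longrightarrow> set hs \<subseteq> carrier G"
  by (auto simp: centralizer_def)

end

section \<open>The maps in conjugation coordinates\<close>

locale conjugacy_setting = finite_group G for G :: "('g, 'm) monoid_scheme" (structure) +
  fixes X :: "'g set" and N :: "'g \<Rightarrow> nat" and \<gamma> :: "'g \<Rightarrow> nat \<Rightarrow> 'g"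
  assumes representatives: "conj_class_representatives G X"
    and transversals: "\<And>x. x \<in> X \<Longrightarrow> right_coset_decomposition G (centralizer G x) (N x) (\<gamma> x)"
begin

abbreviation HH where "HH \<equiv> hochschild_complex G"
abbreviation CS where "CS \<equiv> direct_sum_complex X (\<lambda>x. group_complex (centralizer_group G x))"

lemma X_carrier: "x \<in> X \<Longrightarrow> x \<in> carrier G"
  using representatives unfolding conj_class_representatives_def by blast

lemma finite_X: "finite X"
  using finite_subset[OF _ finite_carrier] X_carrier by blast

lemma X_nonempty: "X \<noteq> {}"
proof -
  have "\<exists>!x. x \<in> X \<and> \<one> \<in> conj_class G x"
    using representatives one_closed unfolding conj_class_representatives_def by blast
  then show ?thesis by blast
qed

lemma centralizer_group: "x \<in> X \<Longrightarrow> group (centralizer_group G x)"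
  by (rule subgroup.subgroup_is_group[OF centralizer_subgroup[OF X_carrier] is_group])

lemma based: "x \<in> X \<Longrightarrow> based_transversal G (centralizer G x) (N x) (\<gamma> x) (carrier G) (conj_act G) x"
  by (intro based_transversal.intro right_transversal.intro right_transversal_axioms.intro
      based_transversal_axioms.intro conj.right_action_axioms is_group
      transversals centralizer_subgroup X_carrier conj_act_centralizer)

lemma transversal: "x \<in> X \<Longrightarrow> right_transversal G (centralizer G x) (N x) (\<gamma> x)"
  by (rule based_transversal.axioms(1)[OF based])

definition point :: "'g \<Rightarrow> nat \<Rightarrow> 'g" where
  "point x i = conj_act G x (\<gamma> x i)"

lemma point_closed [simp]: "x \<in> X \<Longrightarrow> i \<in> {1..N x} \<Longrightarrow> point x i \<in> carrier G"
  unfolding point_def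
  by (rule conj.act_closed[OF X_carrier right_transversal.gamma_closed[OF transversal]])

lemma point_one: "x \<in> X \<Longrightarrow> point x (Suc 0) = x"
  by (simp add: point_def right_transversal.gamma_one[OF transversal] X_carrier)

lemma point_exists:
  assumes y: "y \<in> carrier G"
  obtains x i where "x \<in> X" "i \<in> {1..N x}" "y = point x i"
proof -
  obtain x where x: "x \<in> X" "y \<in> conj_class G x"
    using representatives y unfolding conj_class_representatives_def by blast
  then obtain g where g: "g \<in> carrier G" "y = conj_act G x g" by (auto simp: conj_class_def)
  interpret based_transversal G "centralizer G x" "N x" "\<gamma> x" "carrier G" "conj_act G" x
    by (rule based[OF x(1)])
  obtain h i where hi: "h \<in> centralizer G x" "i \<in> {1..N x}" "g = h \<otimes> \<gamma> x i"
    by (rule coset_representation_exists[OF g(1)])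
  have "y = conj_act G (conj_act G x h) (\<gamma> x i)"
    unfolding g(2) hi(3) by (rule conj.act_mult[OF base H_carrier[OF hi(1)] gamma_closed[OF hi(2)]])
  then have "y = point x i" by (simp only: base_fixed[OF hi(1)] point_def)
  then show ?thesis using that x(1) hi(2) by blast
qed

text \<open>
  Distinct representatives have disjoint classes.  Within a class, \<open>x\<^sub>i = x\<^sub>j\<close> puts \<open>\<gamma>\<^sub>i \<gamma>\<^sub>j\<inverse>\<close> in the
  centralizer, so \<open>\<gamma>\<^sub>i\<close> and \<open>\<gamma>\<^sub>j\<close> represent the same coset.
\<close>
lemma point_unique:
  assumes x: "x \<in> X" "i \<in> {1..N x}" and x': "x' \<in> X" "i' \<in> {1..N x'}"
    and eq: "point x i = point x' i'"
  shows "x = x' \<and> i = i'"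
proof -
  interpret based_transversal G "centralizer G x" "N x" "\<gamma> x" "carrier G" "conj_act G" x
    by (rule based[OF x(1)])
  have in_class: "point z j \<in> conj_class G z" if "z \<in> X" "j \<in> {1..N z}" for z j
    using right_transversal.gamma_closed[OF transversal[OF that(1)] that(2)]
    unfolding point_def conj_class_def by blast
  have "\<exists>!z. z \<in> X \<and> point x i \<in> conj_class G z"
    using representatives point_closed[OF x] unfolding conj_class_representatives_def by blast
  then have xx: "x = x'" using in_class[OF x] in_class[OF x'] x(1) x'(1) eq by auto
  then have i': "i' \<in> {1..N x}" using x'(2) by simp
  note c = gamma_closed[OF x(2)] gamma_closed[OF i']
  define h where "h = \<gamma> x i \<otimes> inv \<gamma> x i'"
  have h: "h \<in> carrier G" using c by (simp add: h_def)
  have g: "\<gamma> x i = h \<otimes> \<gamma> x i'" using c by (simp add: h_def m_assoc)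
  have "conj_act G x (\<gamma> x i) = conj_act G x (\<gamma> x i')" using eq xx by (simp add: point_def)
  then have "conj_act G (conj_act G x (\<gamma> x i)) (inv \<gamma> x i') = conj_act G (conj_act G x (\<gamma> x i')) (inv \<gamma> x i')"
    by simp
  then have "conj_act G x h = conj_act G x (\<gamma> x i' \<otimes> inv \<gamma> x i')"
    unfolding h_def using c base by (simp only: conj.act_mult inv_closed)
  then have "inv h \<otimes> x \<otimes> h = x" using c base by simp
  then have "h \<otimes> (inv h \<otimes> x \<otimes> h) = h \<otimes> x" by simp
  moreover have "h \<otimes> (inv h \<otimes> x \<otimes> h) = x \<otimes> h" using h base by (simp add: m_assoc[symmetric])
  ultimately have "h \<in> centralizer G x" by (intro centralizerI[OF h]) simp
  then have "coset_step G (centralizer G x) (N x) (\<gamma> x) i \<one> = (h, i')"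
    using g c i' by (intro coset_step_eqI) auto
  then show ?thesis using coset_step_one[OF x(2)] xx by simp
qed

text \<open>
  Since each group element is a point \<open>x\<^sub>i\<close> for exactly one pair of \<open>x\<close> and \<open>i\<close>, a sum over all of them
  reads off one coefficient.
\<close>
lemma sum_points:
  fixes c :: "'g \<Rightarrow> nat \<Rightarrow> 'k::field"
  assumes x: "x \<in> X" "i \<in> {1..N x}" and p: "p \<in> carrier G"
  shows "(\<Sum>x'\<in>X. \<Sum>i'=1..N x'. c x' i' * ga_basis (point x' i' \<otimes> p) (point x i \<otimes> p)) = c x i"
proof -
  have summand: "c x' i' * ga_basis (point x' i' \<otimes> p) (point x i \<otimes> p) =
      (if x' = x then if i' = i then c x i else 0 else 0)" if "x' \<in> X" "i' \<in> {1..N x'}" for x' i'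
  proof (cases "point x i = point x' i'")
    case True
    then show ?thesis using point_unique[OF that x] by (simp add: ga_basis_def)
  next
    case False
    then have "ga_basis (point x' i' \<otimes> p) (point x i \<otimes> p) = (0 :: 'k)"
      using right_cancel[OF p point_closed[OF x] point_closed[OF that]] by (simp add: ga_basis_def)
    then show ?thesis using False by auto
  qed
  have "(\<Sum>i'=1..N x'. c x' i' * ga_basis (point x' i' \<otimes> p) (point x i \<otimes> p)) =
      (if x' = x then c x i else 0)" if "x' \<in> X" for x'
  proof -
    have "(\<Sum>i'=1..N x'. c x' i' * ga_basis (point x' i' \<otimes> p) (point x i \<otimes> p)) =
        (\<Sum>i'=1..N x'. if x' = x then if i' = i then c x i else 0 else 0)"
      by (rule sum.cong[OF refl summand[OF that]])
    then show ?thesis using x(2) by (cases "x' = x") simp_all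
  qed
  then have "(\<Sum>x'\<in>X. \<Sum>i'=1..N x'. c x' i' * ga_basis (point x' i' \<otimes> p) (point x i \<otimes> p)) =
      (\<Sum>x'\<in>X. if x' = x then c x i else 0)"
    by (rule sum.cong[OF refl])
  then show ?thesis using x(1) finite_X by simp
qed

text \<open>
  In conjugation coordinates the summand of \<open>x\<close> consists of the families supported on the class of \<open>x\<close>.
  So the projection to it is invisible at \<open>y = x\<close>, the only place where \<open>\<iota>\<close> and \<open>s\<close> evaluate the projected cochain.
\<close>
lemma in_summand:
  assumes "x \<in> X" "p \<in> carrier G"
  shows "x \<otimes> p \<in> p <# conj_class G x"
proof -
  have "x \<otimes> p = p \<otimes> conj_act G x p"
    using assms X_carrier by (simp add: m_assoc[symmetric])
  then show ?thesis using assms(2) unfolding l_coset_def conj_class_def by blast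
qed

lemma iota_apply:
  "iota G X n \<phi> x hs =
    (if x \<in> X \<and> hs \<in> tuples (centralizer_group G x) n then conj_coords G \<phi> x hs else 0)"
proof (cases "x \<in> X \<and> hs \<in> tuples (centralizer_group G x) n")
  case True
  then have hs: "set hs \<subseteq> carrier G" by (auto simp: tuples_def centralizer_def)
  then have "ga_mult G (summand_projection G x \<phi> hs) (ga_basis (list_mult G (rev (map (m_inv G) hs)))) x =
      summand_projection G x \<phi> hs (x \<otimes> list_mult G hs)"
    using True by (simp add: list_mult_rev_inv ga_mult_basis_right X_carrier)
  also have "\<dots> = conj_coords G \<phi> x hs"
    using True hs in_summand by (simp add: summand_projection_def conj_coords_def)
  finally show ?thesis using True by (simp add: iota_def iota_part_def)
qed (auto simp: iota_def iota_part_def)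

lemma iota_apply_subgroup:
  assumes "\<phi> \<in> cochains (hochschild_complex G) n" "x \<in> X" "set hs \<subseteq> centralizer G x"
  shows "iota G X n \<phi> x hs = conj_coords G \<phi> x hs"
proof (cases "hs \<in> tuples (centralizer_group G x) n")
  case False
  then have "hs \<notin> tuples G n" using assms(3) by (auto simp: tuples_def)
  then show ?thesis using False assms(1) by (simp add: iota_apply hochschild_cochains_iff conj_coords_def)
qed (simp add: iota_apply assms)

lemma rho_apply:
  "rho G X N \<gamma> n \<Psi> gs u = (if gs \<in> tuples G n then
     \<Sum>x\<in>X. \<Sum>i=1..N x. \<Psi> x (coset_elements G (centralizer G x) (N x) (\<gamma> x) i gs) *
       ga_basis (point x i \<otimes> list_mult G gs) u else 0)"
  by (simp add: rho_def rho_part_def sum_fun_apply point_def)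

lemma ga_basis_outside: "g \<in> carrier G \<Longrightarrow> u \<notin> carrier G \<Longrightarrow> ga_basis g u = 0"
  by (auto simp: ga_basis_def)

lemma rho_closed: "rho G X N \<gamma> n \<Psi> \<in> cochains (hochschild_complex G) n"
  unfolding hochschild_cochains_iff
proof (intro allI impI)
  fix gs u assume "gs \<notin> tuples G n \<or> u \<notin> carrier G"
  then show "rho G X N \<gamma> n \<Psi> gs u = 0"
    unfolding rho_apply by (auto intro!: sum.neutral simp: ga_basis_outside tuplesD(1))
qed

lemma direct_sum_component:
  assumes "\<Psi> \<in> cochains CS n" "x \<in> X"
  shows "\<Psi> x \<in> cochains (group_complex (centralizer_group G x)) n"
  using assms by (simp add: direct_sum_cochains_iff[OF finite_X])

lemma rho_coords:
  assumes \<Psi>: "\<Psi> \<in> cochains CS n"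
    and x: "x \<in> X" "i \<in> {1..N x}" and gs: "set gs \<subseteq> carrier G" "length gs = n"
  shows "conj_coords G (rho G X N \<gamma> n \<Psi>) (point x i) gs =
    \<Psi> x (coset_elements G (centralizer G x) (N x) (\<gamma> x) i gs)"
proof (cases "\<one> \<in> set gs")
  case True
  then have "\<one> \<in> set (coset_elements G (centralizer G x) (N x) (\<gamma> x) i gs)"
    by (rule right_transversal.one_in_elements[OF transversal[OF x(1)] x(2) gs(1)])
  then have "coset_elements G (centralizer G x) (N x) (\<gamma> x) i gs \<notin> tuples (centralizer_group G x) n"
    by (auto simp: tuples_def)
  moreover have "gs \<notin> tuples G n" using True by (auto simp: tuples_def)
  ultimately show ?thesis
    using direct_sum_component[OF \<Psi> x(1)] by (simp add: conj_coords_def rho_apply group_cochains_iff)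
next
  case False
  then have "gs \<in> tuples G n" using gs by (auto simp: tuples_def)
  then show ?thesis
    unfolding conj_coords_def rho_apply using sum_points[OF x list_mult_in_carrier[OF gs(1)]] by simp
qed

text \<open>
  The tuple \<open>h\<^sub>i\<^sub>1, \<dots>, h\<^sub>i\<^sub>j, \<gamma>, g\<^sub>j\<^sub>+\<^sub>1, \<dots>\<close> has product \<open>\<gamma>\<^sub>i g\<^sub>1 \<cdots> g\<^sub>n\<close> by telescoping, so the
  normalizing factor on the right is the inverse of this product.
\<close>
lemma homotopy_coeff_eq:
  fixes \<phi> :: "'g list \<Rightarrow> 'g \<Rightarrow> 'k::field"
  assumes x: "x \<in> X" "i \<in> {1..N x}" and gs: "set gs \<subseteq> carrier G"
  shows "homotopy_coeff G x (N x) (\<gamma> x) (summand_projection G x \<phi>) gs i j =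
    conj_coords G \<phi> x (coset_elements G (centralizer G x) (N x) (\<gamma> x) i (take j gs) @
      [\<gamma> x (coset_index G (centralizer G x) (N x) (\<gamma> x) i (take j gs))] @ drop j gs)"
proof -
  interpret right_transversal G "centralizer G x" "N x" "\<gamma> x" by (rule transversal[OF x(1)])
  define L where "L = elements i (take j gs) @ [\<gamma> x (index i (take j gs))] @ drop j gs"
  have t: "set (take j gs) \<subseteq> carrier G" "set (drop j gs) \<subseteq> carrier G"
    using gs set_take_subset[of j gs] set_drop_subset[of j gs] by auto
  note el = elements_in_H[OF x(2) t(1)]
  have el': "set (elements i (take j gs)) \<subseteq> carrier G" using el H_carrier by blast
  note g = gamma_closed[OF x(2)] gamma_closed[OF index_closed[OF x(2) t(1)]]
  have "list_mult G L = (list_mult G (elements i (take j gs)) \<otimes> \<gamma> x (index i (take j gs))) \<otimes>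
      list_mult G (drop j gs)"
    unfolding L_def using el' t g by (simp add: list_mult_append list_mult_Cons m_assoc)
  also have "\<dots> = \<gamma> x i \<otimes> (list_mult G (take j gs) \<otimes> list_mult G (drop j gs))"
    unfolding list_mult_elements[OF x(2) t(1)] using t g by (simp add: m_assoc)
  also have "\<dots> = \<gamma> x i \<otimes> list_mult G gs"
    using list_mult_append[OF t] by simp
  finally have L: "list_mult G L = \<gamma> x i \<otimes> list_mult G gs" .
  have Lc: "list_mult G L \<in> carrier G" unfolding L using g gs by simp
  have "list_mult G (rev (map (m_inv G) gs)) \<otimes> inv \<gamma> x i = inv (list_mult G L)"
    unfolding L using g gs by (simp add: list_mult_rev_inv inv_mult_group)
  then have "homotopy_coeff G x (N x) (\<gamma> x) (summand_projection G x \<phi>) gs i j =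
      summand_projection G x \<phi> L (x \<otimes> list_mult G L)"
    unfolding homotopy_coeff_def L_def[symmetric]
    using Lc x(1) by (simp add: ga_mult_basis_right X_carrier)
  also have "\<dots> = conj_coords G \<phi> x L"
    using in_summand[OF x(1) Lc] by (simp add: summand_projection_def conj_coords_def)
  finally show ?thesis by (simp only: L_def)
qed

lemma homotopy_apply:
  "homotopy G X N \<gamma> (Suc n) \<phi> gs u = (if gs \<in> tuples G n then
     \<Sum>x\<in>X. \<Sum>i=1..N x. right_transversal.prism G (centralizer G x) (N x) (\<gamma> x) (conj_coords G \<phi> x) i gs *
       ga_basis (point x i \<otimes> list_mult G gs) u else 0)"
proof (cases "gs \<in> tuples G n")
  case True
  note gs = tuplesD[OF True]
  have "homotopy_part G x (N x) (\<gamma> x) (Suc n) (summand_projection G x \<phi>) gs u =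
      (\<Sum>i=1..N x. right_transversal.prism G (centralizer G x) (N x) (\<gamma> x) (conj_coords G \<phi> x) i gs *
        ga_basis (point x i \<otimes> list_mult G gs) u)" if x: "x \<in> X" for x
  proof -
    interpret right_transversal G "centralizer G x" "N x" "\<gamma> x" by (rule transversal[OF x])
    have "homotopy_part G x (N x) (\<gamma> x) (Suc n) (summand_projection G x \<phi>) gs u =
        (\<Sum>i=1..N x. \<Sum>j=0..n. (- 1) ^ j * homotopy_coeff G x (N x) (\<gamma> x) (summand_projection G x \<phi>) gs i j *
          ga_basis (point x i \<otimes> list_mult G gs) u)"
      using True by (simp add: homotopy_part_def point_def) (rule sum.swap)
    also have "\<dots> = (\<Sum>i=1..N x. prism (conj_coords G \<phi> x) i gs * ga_basis (point x i \<otimes> list_mult G gs) u)"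
      by (rule sum.cong[OF refl])
        (simp add: homotopy_coeff_eq[OF x _ gs(1)] prism_eq_sum gs(2) sum_distrib_right)
    finally show ?thesis .
  qed
  then show ?thesis using True by (simp add: homotopy_def sum_fun_apply)
next
  case False
  then show ?thesis by (simp add: homotopy_def homotopy_part_def sum_fun_apply)
qed

lemma homotopy_zero: "homotopy G X N \<gamma> 0 \<phi> = 0"
  by (simp add: homotopy_def homotopy_part_def fun_eq_iff sum_fun_apply)

lemma homotopy_closed: "homotopy G X N \<gamma> (Suc n) \<phi> \<in> cochains (hochschild_complex G) n"
  unfolding hochschild_cochains_iff
proof (intro allI impI)
  fix gs u assume "gs \<notin> tuples G n \<or> u \<notin> carrier G"
  then show "homotopy G X N \<gamma> (Suc n) \<phi> gs u = 0"
    unfolding homotopy_apply by (auto intro!: sum.neutral simp: ga_basis_outside tuplesD(1))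
qed

lemma homotopy_coords:
  assumes \<phi>: "\<phi> \<in> cochains (hochschild_complex G) (Suc n)"
    and x: "x \<in> X" "i \<in> {1..N x}" and gs: "set gs \<subseteq> carrier G" "length gs = n"
  shows "conj_coords G (homotopy G X N \<gamma> (Suc n) \<phi>) (point x i) gs =
    right_transversal.prism G (centralizer G x) (N x) (\<gamma> x) (conj_coords G \<phi> x) i gs"
proof (cases "\<one> \<in> set gs")
  case True
  then have "gs \<notin> tuples G n" by (auto simp: tuples_def)
  then show ?thesis
    using right_transversal.prism_degenerate[OF transversal[OF x(1)] conj_coords_normalized[OF \<phi>] x(2) gs(1) True]
    by (simp add: conj_coords_def homotopy_apply)
next
  case False
  then have "gs \<in> tuples G n" using gs by (auto simp: tuples_def)
  then show ?thesis
    unfolding conj_coords_def[of G "homotopy G X N \<gamma> (Suc n) \<phi>"] homotopy_apply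
    using sum_points[OF x list_mult_in_carrier[OF gs(1)]] by simp
qed

lemma hochschild_cochain_eqI_points:
  assumes "\<phi> \<in> cochains (hochschild_complex G) n" "\<psi> \<in> cochains (hochschild_complex G) n"
    and "\<And>x i gs. x \<in> X \<Longrightarrow> i \<in> {1..N x} \<Longrightarrow> set gs \<subseteq> carrier G \<Longrightarrow> length gs = n \<Longrightarrow>
      conj_coords G \<phi> (point x i) gs = conj_coords G \<psi> (point x i) gs"
  shows "\<phi> = \<psi>"
  using assms(1,2)
proof (rule hochschild_cochain_eqI)
  fix y gs assume y: "y \<in> carrier G" and gs: "gs \<in> tuples G n"
  obtain x i where "x \<in> X" "i \<in> {1..N x}" "y = point x i" by (rule point_exists[OF y])
  then show "conj_coords G \<phi> y gs = conj_coords G \<psi> y gs" using assms(3) tuplesD[OF gs] by blast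
qed

section \<open>The deformation retract\<close>

lemma CS_complex:
  "cochain_complex (CS :: ('k::field, 'g \<Rightarrow> 'g list \<Rightarrow> 'k) cochain_cpx)"
  by (rule direct_sum_complex_is_complex[OF finite_X group_scalar_vector_space
      group.group_complex_is_complex[OF centralizer_group]])

lemma CS_differential_eq_nerve:
  assumes \<Psi>: "\<Psi> \<in> cochains CS n" and x: "x \<in> X"
    and hs: "set hs \<subseteq> centralizer G x" "length hs = Suc n"
  shows "differential CS n \<Psi> x hs = nerve_differential G act (\<lambda>_. \<Psi> x) y hs"
proof -
  have "differential (group_complex (centralizer_group G x)) n (\<Psi> x) hs =
      nerve_differential (centralizer_group G x) (\<lambda>y g. y) (\<lambda>_. \<Psi> x) y hs"
    by (rule group.group_differential_eq_nerve[OF centralizer_group[OF x] direct_sum_component[OF \<Psi> x]])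
      (use hs in auto)
  also have "\<dots> = nerve_differential G act (\<lambda>_. \<Psi> x) y hs"
    unfolding nerve_differential_carrier_update by (rule nerve_differential_const)
  finally show ?thesis using x by (simp add: direct_sum_differential)
qed

lemma iota_closed: "iota G X n \<phi> \<in> cochains CS n"
  by (auto simp: direct_sum_cochains_iff[OF finite_X] group_cochains_iff iota_apply)

text \<open>
  At the base point \<open>x\<close> the zeroth face does not move, since the centralizer fixes \<open>x\<close>.
\<close>
lemma iota_cochain_map: "cochain_map (HH :: ('k::field, 'g list \<Rightarrow> 'g \<Rightarrow> 'k) cochain_cpx) CS (iota G X)"
  unfolding cochain_map_def
proof (intro conjI allI ballI)
  fix n
  show "linear_from_to (scalar (HH :: ('k, 'g list \<Rightarrow> 'g \<Rightarrow> 'k) cochain_cpx)) (cochains HH n)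
      (scalar CS) (cochains CS n) (iota G X n)"
    unfolding linear_from_to_def
    by (intro conjI ballI allI Pi_I iota_closed ext)
      (simp_all add: iota_apply conj_coords_add conj_coords_scale direct_sum_scalar group_scalar)
  fix \<phi> :: "'g list \<Rightarrow> 'g \<Rightarrow> 'k" assume \<phi>: "\<phi> \<in> cochains HH n"
  show "iota G X (n + 1) (differential HH n \<phi>) = differential CS n (iota G X n \<phi>)"
  proof (intro ext)
    fix x hs
    show "iota G X (n + 1) (differential HH n \<phi>) x hs = differential CS n (iota G X n \<phi>) x hs"
    proof (cases "x \<in> X \<and> hs \<in> tuples (centralizer_group G x) (n + 1)")
      case True
      then have x: "x \<in> X" and hs: "set hs \<subseteq> centralizer G x" "length hs = Suc n"
        by (auto simp: tuples_def)
      interpret based_transversal G "centralizer G x" "N x" "\<gamma> x" "carrier G" "conj_act G" x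
        by (rule based[OF x])
      note hsG = centralizer_carrier[OF hs(1)]
      have \<iota>: "iota G X n \<phi> x t = conj_coords G \<phi> x t" if "set t \<subseteq> centralizer G x" for t
        by (rule iota_apply_subgroup[OF \<phi> x that])
      have "iota G X (n + 1) (differential HH n \<phi>) x hs =
          nerve_differential G (conj_act G) (conj_coords G \<phi>) x hs"
        using True by (simp add: iota_apply hochschild_differential_coords[OF \<phi> hsG hs(2) base])
      also have "\<dots> = nerve_differential G (conj_act G) (\<lambda>_. conj_coords G \<phi> x) x hs"
        using hs base_fixed by (cases hs) auto
      also have "\<dots> = nerve_differential (centralizer_group G x) (\<lambda>y g. y) (\<lambda>_. conj_coords G \<phi> x) x hs"
        unfolding nerve_differential_carrier_update by (rule nerve_differential_const)
      also have "\<dots> = nerve_differential (centralizer_group G x) (\<lambda>y g. y) (\<lambda>_. iota G X n \<phi> x) x hs"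
      proof -
        interpret Z: right_action "centralizer_group G x" UNIV "\<lambda>y g. y"
          by (rule group.trivial_right_action[OF centralizer_group[OF x]])
        show ?thesis by (rule Z.nerve_differential_cong) (use hs \<iota> in auto)
      qed
      also have "\<dots> = differential CS n (iota G X n \<phi>) x hs"
        unfolding nerve_differential_carrier_update
        by (rule CS_differential_eq_nerve[OF iota_closed x hs, symmetric])
      finally show ?thesis .
    next
      case False
      then show ?thesis
        by (auto simp: iota_apply direct_sum_differential group_complex_def)
    qed
  qed
qed

lemma rho_cochain_map: "cochain_map (CS :: ('k::field, 'g \<Rightarrow> 'g list \<Rightarrow> 'k) cochain_cpx) HH (rho G X N \<gamma>)"
  unfolding cochain_map_def
proof (intro conjI allI ballI)
  fix n
  show "linear_from_to (scalar (CS :: ('k, 'g \<Rightarrow> 'g list \<Rightarrow> 'k) cochain_cpx)) (cochains CS n)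
      (scalar HH) (cochains HH n) (rho G X N \<gamma> n)"
    unfolding linear_from_to_def
    by (intro conjI ballI allI Pi_I rho_closed ext)
      (simp_all add: rho_apply direct_sum_scalar group_scalar hochschild_scalar
        distrib_right sum.distrib sum_distrib_left mult.assoc)
  fix \<Psi> :: "'g \<Rightarrow> 'g list \<Rightarrow> 'k" assume \<Psi>: "\<Psi> \<in> cochains CS n"
  have d\<Psi>: "differential CS n \<Psi> \<in> cochains CS (Suc n)"
    using linear_from_toD(1)[OF differential_complex.differential_linear] CS_complex \<Psi>
    by (auto simp: differential_complex_def)
  show "rho G X N \<gamma> (n + 1) (differential CS n \<Psi>) = differential HH n (rho G X N \<gamma> n \<Psi>)"
  proof (rule hochschild_cochain_eqI_points)
    show "rho G X N \<gamma> (n + 1) (differential CS n \<Psi>) \<in> cochains HH (Suc n)"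
      using rho_closed by simp
    show "differential HH n (rho G X N \<gamma> n \<Psi>) \<in> cochains HH (Suc n)"
      by (rule hochschild_differential_closed[OF rho_closed])
    fix x i gs assume x: "x \<in> X" "i \<in> {1..N x}" and gs: "set gs \<subseteq> carrier G" "length gs = Suc n"
    interpret based_transversal G "centralizer G x" "N x" "\<gamma> x" "carrier G" "conj_act G" x
      by (rule based[OF x(1)])
    have "conj_coords G (differential HH n (rho G X N \<gamma> n \<Psi>)) (point x i) gs =
        nerve_differential G (conj_act G) (conj_coords G (rho G X N \<gamma> n \<Psi>)) (point x i) gs"
      by (rule hochschild_differential_coords[OF rho_closed gs point_closed[OF x]])
    also have "\<dots> = nerve_differential G (conj_act G) (\<lambda>_. \<Psi> x) x (elements i gs)"
      unfolding point_def
      by (rule nerve_differential_pullback[OF x(2) gs(1)])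
        (use rho_coords[OF \<Psi> x(1)] gs in \<open>simp add: point_def\<close>)
    also have "\<dots> = differential CS n \<Psi> x (elements i gs)"
      by (rule CS_differential_eq_nerve[OF \<Psi> x(1) elements_in_H[OF x(2) gs(1)], symmetric]) (simp add: gs(2))
    also have "\<dots> = conj_coords G (rho G X N \<gamma> (n + 1) (differential CS n \<Psi>)) (point x i) gs"
      using rho_coords[OF d\<Psi> x gs] by simp
    finally show "conj_coords G (rho G X N \<gamma> (n + 1) (differential CS n \<Psi>)) (point x i) gs =
        conj_coords G (differential HH n (rho G X N \<gamma> n \<Psi>)) (point x i) gs" by simp
  qed
qed

lemma homotopy_linear:
  "linear_from_to (scalar (HH :: ('k::field, 'g list \<Rightarrow> 'g \<Rightarrow> 'k) cochain_cpx)) (cochains HH (Suc n))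
    (scalar HH) (cochains HH n) (homotopy G X N \<gamma> (Suc n))"
  unfolding linear_from_to_def
proof (intro conjI ballI allI Pi_I homotopy_closed ext)
  note prism_simps = right_transversal.prism_add[OF transversal] right_transversal.prism_cmult[OF transversal]
  fix \<phi> \<psi> :: "'g list \<Rightarrow> 'g \<Rightarrow> 'k" and c gs u
  show "homotopy G X N \<gamma> (Suc n) (\<phi> + \<psi>) gs u =
      (homotopy G X N \<gamma> (Suc n) \<phi> + homotopy G X N \<gamma> (Suc n) \<psi>) gs u"
    by (simp add: homotopy_apply conj_coords_add prism_simps distrib_right sum.distrib cong: sum.cong)
  show "homotopy G X N \<gamma> (Suc n) (scalar HH c \<phi>) gs u = scalar HH c (homotopy G X N \<gamma> (Suc n) \<phi>) gs u"
    by (simp add: homotopy_apply conj_coords_scale prism_simps hochschild_scalar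
        sum_distrib_left mult.assoc cong: sum.cong)
qed

lemma iota_rho:
  assumes \<Psi>: "\<Psi> \<in> cochains CS n"
  shows "iota G X n (rho G X N \<gamma> n \<Psi>) = \<Psi>"
proof (intro ext)
  fix x hs
  show "iota G X n (rho G X N \<gamma> n \<Psi>) x hs = \<Psi> x hs"
  proof (cases "x \<in> X \<and> hs \<in> tuples (centralizer_group G x) n")
    case True
    then have x: "x \<in> X" and hs: "set hs \<subseteq> centralizer G x" "length hs = n"
      by (auto simp: tuples_def)
    interpret right_transversal G "centralizer G x" "N x" "\<gamma> x" by (rule transversal[OF x])
    show ?thesis
      using True rho_coords[OF \<Psi> x one_index centralizer_carrier[OF hs(1)] hs(2)] elements_subgroup[OF hs(1)]
      by (simp add: iota_apply point_one[OF x])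
  next
    case False
    then show ?thesis
      using \<Psi> by (auto simp: iota_apply direct_sum_cochains_iff[OF finite_X] group_cochains_iff)
  qed
qed

text \<open>
  In degree \<open>0\<close> the term \<open>\<delta> \<circ> s\<close> is absent, which agrees with the differential of the nerve being
  zero on the empty list.
\<close>
lemma homotopy_identity:
  assumes \<phi>: "\<phi> \<in> cochains HH n"
  shows "\<phi> - rho G X N \<gamma> n (iota G X n \<phi>) =
    (if n = 0 then 0 else differential HH (n - 1) (homotopy G X N \<gamma> n \<phi>)) +
    homotopy G X N \<gamma> (Suc n) (differential HH n \<phi>)"
    (is "?L = ?B + ?S")
proof (rule hochschild_cochain_eqI_points)
  interpret HH: differential_complex HH
    by (simp add: differential_complex_def hochschild_complex_is_complex)
  note sub = HH.cochains_subspace[of n]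
  have B: "?B \<in> cochains HH n"
  proof (cases n)
    case (Suc m)
    then show ?thesis using hochschild_differential_closed[OF homotopy_closed[of m]] by simp
  qed (simp add: HH.vs.subspace_0[OF HH.cochains_subspace])
  show "?L \<in> cochains HH n" by (rule HH.vs.subspace_diff[OF sub \<phi> rho_closed])
  show "?B + ?S \<in> cochains HH n" by (rule HH.vs.subspace_add[OF sub B homotopy_closed])
  fix x i gs assume x: "x \<in> X" "i \<in> {1..N x}" and gs: "set gs \<subseteq> carrier G" "length gs = n"
  interpret based_transversal G "centralizer G x" "N x" "\<gamma> x" "carrier G" "conj_act G" x
    by (rule based[OF x(1)])
  have \<rho>: "conj_coords G (rho G X N \<gamma> n (iota G X n \<phi>)) (point x i) gs = conj_coords G \<phi> x (elements i gs)"
    using rho_coords[OF iota_closed[of n \<phi>] x gs] iota_apply_subgroup[OF \<phi> x(1) elements_in_H[OF x(2) gs(1)]] by simp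
  define \<Sigma> where "\<Sigma> = conj_coords G (homotopy G X N \<gamma> n \<phi>)"
  have B_coords: "conj_coords G ?B (point x i) gs = nerve_differential G (conj_act G) \<Sigma> (point x i) gs"
  proof (cases n)
    case 0
    then show ?thesis using gs(2) by (simp add: conj_coords_def)
  next
    case (Suc m)
    then show ?thesis
      using hochschild_differential_coords[OF homotopy_closed[of m] gs(1) _ point_closed[OF x]] gs(2)
      by (simp add: \<Sigma>_def)
  qed
  have S_coords: "conj_coords G ?S (point x i) gs =
      prism (conj_coords G (differential HH n \<phi>) x) i gs"
    by (rule homotopy_coords[OF hochschild_differential_closed[OF \<phi>] x gs])
  have "conj_coords G \<phi> (point x i) gs - conj_coords G \<phi> x (elements i gs) =
      nerve_differential G (conj_act G) \<Sigma> (point x i) gs +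
      prism (conj_coords G (differential HH n \<phi>) x) i gs"
    unfolding point_def
  proof (rule prism_homotopy[OF x(2) gs(1)])
    fix s t assume s: "s \<in> {1..N x}" and t: "set t \<subseteq> carrier G" "Suc (length t) = length gs"
    then obtain m where m: "n = Suc m" "length t = m" using gs(2) by auto
    show "\<Sigma> (conj_act G x (\<gamma> x s)) t = prism (conj_coords G \<phi> x) s t"
      using homotopy_coords[of \<phi> m, OF _ x(1) s t(1) m(2)] \<phi> unfolding \<Sigma>_def m(1) point_def by simp
  next
    fix t assume "set t \<subseteq> carrier G" "length t = Suc (length gs)"
    then show "conj_coords G (differential HH n \<phi>) x t =
        nerve_differential G (conj_act G) (conj_coords G \<phi>) x t"
      using hochschild_differential_coords[OF \<phi> _ _ base] gs(2) by simp
  qed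
  then show "conj_coords G ?L (point x i) gs = conj_coords G (?B + ?S) (point x i) gs"
    by (simp only: conj_coords_diff conj_coords_add \<rho> B_coords S_coords)
qed

lemma deformation_retract:
  "homotopy_deformation_retract (HH :: ('k::field, 'g list \<Rightarrow> 'g \<Rightarrow> 'k) cochain_cpx) CS
     (iota G X) (rho G X N \<gamma>) (homotopy G X N \<gamma>)"
  unfolding homotopy_deformation_retract_def
  by (intro conjI allI ballI hochschild_complex_is_complex CS_complex iota_cochain_map rho_cochain_map
      homotopy_linear[unfolded Suc_eq_plus1] homotopy_zero iota_rho homotopy_identity[unfolded Suc_eq_plus1])

lemma cohomology_decomposition:
  "induce_inverse_cohomology_isos (HH :: ('k::field, 'g list \<Rightarrow> 'g \<Rightarrow> 'k) cochain_cpx)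
     X (\<lambda>x. group_complex (centralizer_group G x)) n
     (\<lambda>x \<phi>. iota G X n \<phi> x) (\<lambda>x. rho_part G x (N x) (\<gamma> x) n)"
proof (rule retract_onto_direct_sum_cohomology[OF finite_X X_nonempty group_scalar_vector_space _ deformation_retract])
  show "cochain_complex (group_complex (centralizer_group G x))" if "x \<in> X" for x
    by (rule group.group_complex_is_complex[OF centralizer_group[OF that]])
  show "rho G X N \<gamma> n b = (\<Sum>x\<in>X. rho_part G x (N x) (\<gamma> x) n (b x))" for n b
    by (simp add: rho_def)
  show "rho_part G x (N x) (\<gamma> x) n 0 = 0" for x n
    by (simp add: rho_part_def fun_eq_iff)
qed

end

theorem theorem4p3:
  fixes G :: "('g, 'm) monoid_scheme"
    and X :: "'g set"
    and N :: "'g \<Rightarrow> nat"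
    and \<gamma> :: "'g \<Rightarrow> nat \<Rightarrow> 'g"
  assumes "group G"
    and "finite (carrier G)"
    and "conj_class_representatives G X"
    and "\<And>x. x \<in> X \<Longrightarrow> right_coset_decomposition G (centralizer G x) (N x) (\<gamma> x)"
  shows "homotopy_deformation_retract
           (hochschild_complex G :: ('k::field, 'g list \<Rightarrow> 'g \<Rightarrow> 'k) cochain_cpx)
           (direct_sum_complex X (\<lambda>x. group_complex (centralizer_group G x)))
           (iota G X) (rho G X N \<gamma>) (homotopy G X N \<gamma>) \<and>
         (\<forall>n. induce_inverse_cohomology_isos
           (hochschild_complex G :: ('k, 'g list \<Rightarrow> 'g \<Rightarrow> 'k) cochain_cpx)
           X (\<lambda>x. group_complex (centralizer_group G x)) n
           (\<lambda>x \<phi>. iota G X n \<phi> x)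
           (\<lambda>x. rho_part G x (N x) (\<gamma> x) n))"
proof -
  interpret conjugacy_setting G X N \<gamma>
    by (intro conjugacy_setting.intro finite_group.intro finite_group_axioms.intro
        conjugacy_setting_axioms.intro assms)
  show ?thesis using deformation_retract cohomology_decomposition by blast
qed

end
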